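(* Fix $T_\ast\in(0,\infty]$, $\beta>0$ and $0\le s<d/2$. Let $(\mu^t)_{0\le t<T_\ast}$ solve the McKean--Vlasov equation $$\partial_t\mu^t=\frac1\beta\Delta\mu^t+\operatorname{div}(\mu^t\nabla h_{\mu^t}),\qquad h_{\mu^t}=\mathsf g*\mu^t,$$ and assume that this solution admits a globally Lipschitz velocity field $u^t$ satisfying $\partial_t\mu^t+\operatorname{div}(\mu^tu^t)=0$. Let $(f_N^t)_{0\le t<T_\ast}$ be a curve of $N$-particle probability laws on $(\mathbb R^d)^N$ and write $\mathsf E_N^t=\mathsf E_N(f_N^t,\mu^t)$. Assume that $t\mapsto\mathsf E_N^t$ is absolutely continuous and that $$\frac{d}{dt}\mathsf E_N^t\le\frac1N\Big|\mathbb E_{X_N\sim f_N^t}\big[N\mathsf A_1(u^t,X_N,\mu^t)\big]\Big|\qquad\text{for a.e. }t\in(0,T_\ast).$$ Assume also that, for a.e. $t\in(0,T_\ast)$, $\mu^t\in L^\infty\cap\mathcal P(\mathbb R^d)$, $u^t$ is globally Lipschitz and, if $s=0$, $\int_{(\mathbb R^d)^2}|\log|x-y||\,d(\mu^t)^{\otimes2}(x,y)<\infty$. Set $$\mathcal A^t=\exp\Big(\int_0^tC_{\beta,1,u^\tau}(\mu^\tau)\,d\tau\Big),\qquad \mathcal B^t=\int_0^t\exp\Big(\int_\tau^tC_{\beta,1,u^r}(\mu^r)\,dr\Big)C_{\beta,\mu^\tau,u^\tau,1}\,d\tau .$$ If these quantities are finite for every $t<T_\ast$, then $$\mathsf E_N(f_N^t,\mu^t)\le\mathcal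 A^t\,\mathsf E_N(f_N^0,\mu^0)+\frac{\mathcal B^t}{N},\qquad 0\le t<T_\ast .$$
   Context: Fix a dimension $d\ge1$. $\mathcal P(E)$ denotes the Borel probability measures on $E$; measures with a Lebesgue density are identified with it. For $0\le s<d$ let $\mathsf g(x)=-\log|x|$ if $s=0$ and $\mathsf g(x)=\frac1s|x|^{-s}$ if $0<s<d$. For $\mu\in\mathcal P(\mathbb R^d)$: $h_\mu=\mathsf g*\mu$, $I_\mu=\frac12\int h_\mu\,d\mu$, $\tilde{\mathsf g}(x,y)=\mathsf g(x-y)-h_\mu(x)-h_\mu(y)+2I_\mu$, and for $X_N=(x_1,\dots,x_N)$ $$\mathsf F_N(X_N,\mu)=\frac1{2N^2}\sum_{i\ne j}\tilde{\mathsf g}(x_i,x_j)-\frac1{N^2}\sum_ih_\mu(x_i)+\frac1NI_\mu,\qquad \mathsf K_{N,\beta}(\mu)=\mathbb E_{\mu^{\otimes N}}[e^{-\beta N\mathsf F_N}],$$ $d\mathbb Q_{N,\beta}(\mu)=\mathsf K_{N,\beta}(\mu)^{-1}e^{-\beta N\mathsf F_N(\cdot,\mu)}d\mu^{\otimes N}$, and $\mathsf E_N(f_N,\mu)=\frac1{\beta N}\mathsf H(f_N|\mu^{\otimes N})+\mathbb E_{f_N}[\mathsf F_N(X_N,\mu)]$, with $\mathsf H$ the (unnormalized) relative entropy. With $\mu_N=\frac1N\sum_i\delta_{x_i}$ and $\triangle$ the diagonal, $$\mathsf A_1(v,X_N,\mu)=\int_{(\mathbb R^d)^2\setminus\triangle}\nabla\mathsf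 g(x-y)\cdot(v(x)-v(y))\,d(\mu_N-\mu)^{\otimes2}(x,y).$$ Constants: for $0\le s<d/2$, $\mu\in L^\infty\cap\mathcal P(\mathbb R^d)$ (with $\iint|\log|x-y||d\mu^{\otimes2}<\infty$ if $s=0$) and globally Lipschitz $v$, fix constants $\varepsilon=\varepsilon_{\beta,1}(\mu,v)>0$ and $C_{\mathrm{em}}(\beta,\mu,v,1)<\infty$ such that $\sup_{N\ge1}\mathbb E_{\mathbb Q_{N,\beta}(\mu)}[e^{\sigma\varepsilon N\mathsf A_1(v,X_N,\mu)}]\le C_{\mathrm{em}}(\beta,\mu,v,1)$ for both $\sigma\in\{\pm1\}$, and a finite $C_{\mathrm{ub}}(\beta,\mu)\ge\sup_{N\ge1}\mathsf K_{N,\beta}(\mu)$; such constants exist under these hypotheses. Put $C_{\mathrm{pf}}=\max\{e,C_{\mathrm{ub}}\}$ and $$C_{\beta,1,v}(\mu)=\frac\beta{\varepsilon_{\beta,1}(\mu,v)},\qquad C_{\beta,\mu,v,1}=\frac1{\varepsilon_{\beta,1}(\mu,v)}\big(\log C_{\mathrm{pf}}(\beta,\mu)+\log C_{\mathrm{em}}(\beta,\mu,v,1)\big).$$ *)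

theory Defs
  imports "HOL-Probability.Probability"
begin

section \<open>Calculus in \<open>\<real>\<^sup>d\<close>\<close>

text \<open>The space \<open>\<real>\<^sup>d\<close> with \<open>d \<ge> 1\<close> is a type of class \<^class>\<open>euclidean_space\<close>, \<open>d = DIM('a)\<close>.\<close>

definition partial_deriv :: "'a \<Rightarrow> ('a::euclidean_space \<Rightarrow> real) \<Rightarrow> 'a \<Rightarrow> real" where
  "partial_deriv b f x = frechet_derivative f (at x) b"

definition grad :: "('a::euclidean_space \<Rightarrow> real) \<Rightarrow> 'a \<Rightarrow> 'a" where
  "grad f x = (\<Sum>b\<in>Basis. partial_deriv b f x *\<^sub>R b)"

definition laplacian :: "('a::euclidean_space \<Rightarrow> real) \<Rightarrow> 'a \<Rightarrow> real" where
  "laplacian f x = (\<Sum>b\<in>Basis. partial_deriv b (partial_deriv b f) x)"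

text \<open>Functions of class \<open>C\<^sup>k\<close> on the whole space, and test functions \<open>C\<^sub>c\<^sup>\<infinity>(\<real>\<^sup>d)\<close>.\<close>

primrec Ck :: "nat \<Rightarrow> ('a::euclidean_space \<Rightarrow> real) \<Rightarrow> bool" where
  "Ck 0 f \<longleftrightarrow> continuous_on UNIV f"
| "Ck (Suc k) f \<longleftrightarrow>
     (\<forall>x. f differentiable (at x)) \<and> (\<forall>b\<in>Basis. Ck k (partial_deriv b f))"

definition test_function :: "('a::euclidean_space \<Rightarrow> real) \<Rightarrow> bool" where
  "test_function \<phi> \<longleftrightarrow>
     (\<forall>k. Ck k \<phi>) \<and> (\<exists>K. compact K \<and> (\<forall>x. x \<notin> K \<longrightarrow> \<phi> x = 0))"

definition weak_grad :: "('a::euclidean_space \<Rightarrow> real) \<Rightarrow> ('a \<Rightarrow> 'a) \<Rightarrow> bool" where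
  "weak_grad h G \<longleftrightarrow>
     (\<forall>K. compact K \<longrightarrow> set_integrable lborel K h \<and> set_integrable lborel K G) \<and>
     (\<forall>\<phi>. test_function \<phi> \<longrightarrow> (\<forall>b\<in>Basis.
        (LBINT x. h x * partial_deriv b \<phi> x) = - (LBINT x. (G x \<bullet> b) * \<phi> x)))"

definition globally_lipschitz :: "('a::euclidean_space \<Rightarrow> 'a) \<Rightarrow> bool" where
  "globally_lipschitz v \<longleftrightarrow> (\<exists>L. L-lipschitz_on UNIV v)"

definition abs_continuous_on :: "real set \<Rightarrow> (real \<Rightarrow> real) \<Rightarrow> bool" where
  "abs_continuous_on S f \<longleftrightarrow>
     (\<forall>e>0. \<exists>\<delta>>0. \<forall>(n::nat) a b.
        (\<forall>i<n. a i \<le> b i \<and> {a i..b i} \<subseteq> S) \<and>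
        (\<forall>i<n. \<forall>j<n. i \<noteq> j \<longrightarrow> {a i<..<b i} \<inter> {a j<..<b j} = {}) \<and>
        (\<Sum>i<n. b i - a i) < \<delta>
        \<longrightarrow> (\<Sum>i<n. \<bar>f (b i) - f (a i)\<bar>) < e)"


section \<open>Riesz and logarithmic interaction\<close>

text \<open>
  By the library conventions for ln and powr, \<open>riesz s 0\<close> is \<open>0\<close> instead of \<open>+\<infinity>\<close>. It plays no role once the
  self-energy of \<open>\<mu>\<close> is finite: then \<open>\<mu>\<close> has no atoms, and neither \<open>\<mu> \<otimes> \<mu>\<close> nor a law that is
  absolutely continuous with respect to \<open>\<mu>\<^sup>\<otimes>\<^sup>N\<close> charges coinciding points.
\<close>

definition riesz :: "real \<Rightarrow> 'a::euclidean_space \<Rightarrow> real" where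
  "riesz s x = (if s = 0 then - ln (norm x) else (1 / s) * norm x powr (- s))"

definition potential :: "real \<Rightarrow> 'a::euclidean_space measure \<Rightarrow> 'a \<Rightarrow> real" where
  "potential s \<mu> x = (\<integral>y. riesz s (x - y) \<partial>\<mu>)"

definition self_energy :: "real \<Rightarrow> 'a::euclidean_space measure \<Rightarrow> real" where
  "self_energy s \<mu> = (1 / 2) * (\<integral>x. potential s \<mu> x \<partial>\<mu>)"

definition centered_kernel :: "real \<Rightarrow> 'a::euclidean_space measure \<Rightarrow> 'a \<Rightarrow> 'a \<Rightarrow> real" where
  "centered_kernel s \<mu> x y =
     riesz s (x - y) - potential s \<mu> x - potential s \<mu> y + 2 * self_energy s \<mu>"

definition borel_prob :: "'a::euclidean_space measure \<Rightarrow> bool" where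
  "borel_prob \<mu> \<longleftrightarrow> sets \<mu> = sets borel \<and> prob_space \<mu>"

definition bounded_density :: "'a::euclidean_space measure \<Rightarrow> bool" where
  "bounded_density \<mu> \<longleftrightarrow>
     (\<exists>\<rho> C. \<rho> \<in> borel_measurable borel \<and> (\<forall>x. 0 \<le> \<rho> x \<and> \<rho> x \<le> C) \<and>
            \<mu> = density lborel (\<lambda>x. ennreal (\<rho> x)))"

text \<open>\<open>\<mu> \<in> L\<^sup>\<infinity> \<inter> \<P>(\<real>\<^sup>d)\<close>, with finite absolute logarithmic energy when \<open>s = 0\<close>.\<close>

definition admissible :: "real \<Rightarrow> 'a::euclidean_space measure \<Rightarrow> bool" where
  "admissible s \<mu> \<longleftrightarrow> borel_prob \<mu> \<and> bounded_density \<mu> \<and>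
     (s = 0 \<longrightarrow> (\<integral>\<^sup>+(x, y). ennreal \<bar>ln (norm (x - y))\<bar> \<partial>(\<mu> \<Otimes>\<^sub>M \<mu>)) < \<infinity>)"


section \<open>\<open>N\<close>-particle quantities\<close>

text \<open>Configurations \<open>X\<^sub>N\<close> are elements of \<open>\<Pi>\<^sub>E i\<in>{..<N}. UNIV\<close>.\<close>

definition tensor_power :: "nat \<Rightarrow> 'a::euclidean_space measure \<Rightarrow> (nat \<Rightarrow> 'a) measure" where
  "tensor_power N \<mu> = PiM {..<N} (\<lambda>_. \<mu>)"

definition particle_law :: "nat \<Rightarrow> (nat \<Rightarrow> 'a::euclidean_space) measure \<Rightarrow> bool" where
  "particle_law N f \<longleftrightarrow> sets f = sets (PiM {..<N} (\<lambda>_. borel)) \<and> prob_space f"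

definition mod_energy :: "real \<Rightarrow> nat \<Rightarrow> (nat \<Rightarrow> 'a::euclidean_space) \<Rightarrow> 'a measure \<Rightarrow> real" where
  "mod_energy s N X \<mu> =
     1 / (2 * real N ^ 2) * (\<Sum>i<N. \<Sum>j\<in>{..<N} - {i}. centered_kernel s \<mu> (X i) (X j))
     - 1 / real N ^ 2 * (\<Sum>i<N. potential s \<mu> (X i))
     + 1 / real N * self_energy s \<mu>"

definition partition_fun :: "real \<Rightarrow> real \<Rightarrow> nat \<Rightarrow> 'a::euclidean_space measure \<Rightarrow> ennreal" where
  "partition_fun s \<beta> N \<mu> =
     (\<integral>\<^sup>+X. ennreal (exp (- \<beta> * real N * mod_energy s N X \<mu>)) \<partial>tensor_power N \<mu>)"

definition mod_gibbs ::
    "real \<Rightarrow> real \<Rightarrow> nat \<Rightarrow> 'a::euclidean_space measure \<Rightarrow> (nat \<Rightarrow> 'a) measure" where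
  "mod_gibbs s \<beta> N \<mu> =
     density (tensor_power N \<mu>)
       (\<lambda>X. ennreal (exp (- \<beta> * real N * mod_energy s N X \<mu>)) / partition_fun s \<beta> N \<mu>)"

text \<open>
  Relative entropy of \<open>P\<close> with respect to \<open>M\<close>. The library's \<^const>\<open>KL_divergence\<close> is real-valued, with
  the reference measure as first measure argument. For probability measures the negative part of
  \<open>log (dP/dM)\<close> is always \<open>P\<close>-integrable, so failure of integrability means that the entropy is \<open>+\<infinity>\<close>.
\<close>

definition rel_entropy :: "'b measure \<Rightarrow> 'b measure \<Rightarrow> ereal" where
  "rel_entropy P M =
     (if absolutely_continuous M P \<and> integrable P (entropy_density (exp 1) M P)
      then ereal (KL_divergence (exp 1) M P) else \<infinity>)"

definition ext_expectation :: "'b measure \<Rightarrow> ('b \<Rightarrow> real) \<Rightarrow> ereal" where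
  "ext_expectation P F =
     enn2ereal (\<integral>\<^sup>+x. ennreal (F x) \<partial>P) - enn2ereal (\<integral>\<^sup>+x. ennreal (- F x) \<partial>P)"

text \<open>
  Since \<open>\<infinity> - \<infinity> = \<infinity>\<close> in \<^typ>\<open>ereal\<close>, this is finite only if the entropy is finite and the energy is
  integrable.
\<close>

definition mod_free_energy ::
    "real \<Rightarrow> real \<Rightarrow> nat \<Rightarrow> (nat \<Rightarrow> 'a::euclidean_space) measure \<Rightarrow> 'a measure \<Rightarrow> ereal" where
  "mod_free_energy s \<beta> N f \<mu> =
     ereal (1 / (\<beta> * real N)) * rel_entropy f (tensor_power N \<mu>)
     + ext_expectation f (\<lambda>X. mod_energy s N X \<mu>)"

definition empirical :: "nat \<Rightarrow> (nat \<Rightarrow> 'a::euclidean_space) \<Rightarrow> 'a measure" where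
  "empirical N X = distr (uniform_count_measure {..<N}) borel X"

definition offdiag_integral ::
    "'a measure \<Rightarrow> 'a measure \<Rightarrow> ('a \<Rightarrow> 'a::euclidean_space \<Rightarrow> real) \<Rightarrow> real" where
  "offdiag_integral \<mu> \<nu> k = (LINT p:{(x, y). x \<noteq> y}|(\<mu> \<Otimes>\<^sub>M \<nu>). k (fst p) (snd p))"

text \<open>Integration against the signed measure \<open>(\<nu> - \<mu>)\<^sup>\<otimes>\<^sup>2\<close> off the diagonal, by bilinear expansion.\<close>

definition offdiag_square ::
    "'a measure \<Rightarrow> 'a measure \<Rightarrow> ('a \<Rightarrow> 'a::euclidean_space \<Rightarrow> real) \<Rightarrow> real" where
  "offdiag_square \<nu> \<mu> k =
     offdiag_integral \<nu> \<nu> k - offdiag_integral \<nu> \<mu> k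
     - offdiag_integral \<mu> \<nu> k + offdiag_integral \<mu> \<mu> k"

definition commutator ::
    "real \<Rightarrow> nat \<Rightarrow> ('a \<Rightarrow> 'a) \<Rightarrow> (nat \<Rightarrow> 'a::euclidean_space) \<Rightarrow> 'a measure \<Rightarrow> real" where
  "commutator s N v X \<mu> =
     offdiag_square (empirical N X) \<mu> (\<lambda>x y. grad (riesz s) (x - y) \<bullet> (v x - v y))"


section \<open>Constants\<close>

text \<open>
  \<open>eps\<close>, \<open>Cem\<close> and \<open>Cub\<close> are the chosen constants as functions of \<open>\<mu>\<close> and \<open>v\<close>; \<open>\<beta>\<close> and \<open>s\<close> are
  fixed throughout.
\<close>

definition exp_moment_bound ::
    "real \<Rightarrow> real \<Rightarrow> ('a measure \<Rightarrow> ('a \<Rightarrow> 'a) \<Rightarrow> real) \<Rightarrow>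
     ('a::euclidean_space measure \<Rightarrow> ('a \<Rightarrow> 'a) \<Rightarrow> real) \<Rightarrow> bool" where
  "exp_moment_bound s \<beta> eps Cem \<longleftrightarrow>
     (\<forall>\<mu> v. admissible s \<mu> \<and> globally_lipschitz v \<longrightarrow>
        eps \<mu> v > 0 \<and>
        (\<forall>N\<ge>1. \<forall>\<sigma>\<in>{1, -1}.
           (\<integral>\<^sup>+X. ennreal (exp (\<sigma> * eps \<mu> v * real N * commutator s N v X \<mu>)) \<partial>mod_gibbs s \<beta> N \<mu>)
           \<le> ennreal (Cem \<mu> v)))"

definition partition_bound ::
    "real \<Rightarrow> real \<Rightarrow> ('a::euclidean_space measure \<Rightarrow> real) \<Rightarrow> bool" where
  "partition_bound s \<beta> Cub \<longleftrightarrow>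
     (\<forall>\<mu>. admissible s \<mu> \<longrightarrow> (\<forall>N\<ge>1. partition_fun s \<beta> N \<mu> \<le> ennreal (Cub \<mu>)))"

definition rate_const ::
    "real \<Rightarrow> ('a measure \<Rightarrow> ('a \<Rightarrow> 'a) \<Rightarrow> real) \<Rightarrow> 'a measure \<Rightarrow> ('a \<Rightarrow> 'a) \<Rightarrow> real" where
  "rate_const \<beta> eps \<mu> v = \<beta> / eps \<mu> v"

definition error_const ::
    "('a measure \<Rightarrow> ('a \<Rightarrow> 'a) \<Rightarrow> real) \<Rightarrow> ('a measure \<Rightarrow> ('a \<Rightarrow> 'a) \<Rightarrow> real) \<Rightarrow>
     ('a measure \<Rightarrow> real) \<Rightarrow> 'a measure \<Rightarrow> ('a \<Rightarrow> 'a) \<Rightarrow> real" where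
  "error_const eps Cem Cub \<mu> v = 1 / eps \<mu> v * (ln (max (exp 1) (Cub \<mu>)) + ln (Cem \<mu> v))"

definition growth_factor :: "(real \<Rightarrow> real) \<Rightarrow> real \<Rightarrow> real \<Rightarrow> real" where
  "growth_factor c r t = exp (LINT \<tau>:{r..t}|lebesgue. c \<tau>)"

definition accumulated_error :: "(real \<Rightarrow> real) \<Rightarrow> (real \<Rightarrow> real) \<Rightarrow> real \<Rightarrow> real" where
  "accumulated_error c b t = (LINT \<tau>:{0..t}|lebesgue. growth_factor c \<tau> t * b \<tau>)"


section \<open>Weak solutions\<close>

text \<open>
  \<open>\<partial>\<^sub>t\<mu>\<^sup>t = L\<^sub>t\<^sup>* \<mu>\<^sup>t\<close> in the sense of distributions on \<open>(0,T) \<times> \<real>\<^sup>d\<close>, for a curve on \<open>[0,T)\<close> that is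
  continuous in time against test functions; \<open>L t \<phi>\<close> is the formal adjoint operator applied to the
  test function \<open>\<phi>\<close>.
\<close>

definition weak_evolution ::
    "ereal \<Rightarrow> (real \<Rightarrow> 'a::euclidean_space measure) \<Rightarrow> (real \<Rightarrow> ('a \<Rightarrow> real) \<Rightarrow> 'a \<Rightarrow> real) \<Rightarrow> bool" where
  "weak_evolution T \<mu> L \<longleftrightarrow>
     (\<forall>\<phi>. test_function \<phi> \<longrightarrow>
        continuous_on {t. 0 \<le> t \<and> ereal t < T} (\<lambda>t. \<integral>x. \<phi> x \<partial>\<mu> t) \<and>
        (AE t in lborel. 0 < t \<and> ereal t < T \<longrightarrow> integrable (\<mu> t) (L t \<phi>)) \<and>
        (\<forall>r t. 0 < r \<and> r \<le> t \<and> ereal t < T \<longrightarrow>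
           set_integrable lebesgue {r..t} (\<lambda>\<tau>. \<integral>x. L \<tau> \<phi> x \<partial>\<mu> \<tau>) \<and>
           (\<integral>x. \<phi> x \<partial>\<mu> t) - (\<integral>x. \<phi> x \<partial>\<mu> r)
             = (LINT \<tau>:{r..t}|lebesgue. (\<integral>x. L \<tau> \<phi> x \<partial>\<mu> \<tau>))))"

text \<open>\<open>\<partial>\<^sub>t\<mu>\<^sup>t = (1/\<beta>) \<Delta>\<mu>\<^sup>t + div (\<mu>\<^sup>t \<nabla>h)\<close>, with \<open>G t\<close> the weak gradient of \<open>h = g * \<mu>\<^sup>t\<close>.\<close>

definition mckean_vlasov_solution ::
    "real \<Rightarrow> real \<Rightarrow> ereal \<Rightarrow> (real \<Rightarrow> 'a::euclidean_space measure) \<Rightarrow> bool" where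
  "mckean_vlasov_solution s \<beta> T \<mu> \<longleftrightarrow>
     (\<exists>G. (AE t in lborel. 0 < t \<and> ereal t < T \<longrightarrow> weak_grad (potential s (\<mu> t)) (G t)) \<and>
          weak_evolution T \<mu> (\<lambda>t \<phi> x. (1 / \<beta>) * laplacian \<phi> x - grad \<phi> x \<bullet> G t x))"

text \<open>\<open>\<partial>\<^sub>t\<mu>\<^sup>t + div (\<mu>\<^sup>t u\<^sup>t) = 0\<close>.\<close>

definition continuity_equation ::
    "ereal \<Rightarrow> (real \<Rightarrow> 'a::euclidean_space measure) \<Rightarrow> (real \<Rightarrow> 'a \<Rightarrow> 'a) \<Rightarrow> bool" where
  "continuity_equation T \<mu> u \<longleftrightarrow> weak_evolution T \<mu> (\<lambda>t \<phi> x. grad \<phi> x \<bullet> u t x)"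

end

theory Submission
  imports Defs
begin

text \<open>
  By the entropy inequality relative to \<open>\<mu>\<^sup>\<otimes>\<^sup>N\<close> with test function
  \<open>\<plusminus>\<epsilon> N A\<^sub>1 - \<beta> N F\<^sub>N\<close>, the expectation of \<open>\<epsilon> N A\<^sub>1\<close> under \<open>f\<^sub>N\<close> is at
  most \<open>\<beta> N E\<^sub>N\<close> plus the logarithm of the exponential moment, in absolute value. The
  dissipation inequality thereby becomes a linear differential inequality for \<open>E\<^sub>N\<close>, valid almost
  everywhere. Absolute continuity turns it into an integral inequality on every subinterval, and
  Gronwall's argument with an integrable rate gives the bound.
\<close>

section \<open>Absolutely continuous functions\<close>

text \<open>The term \<open>- \<beta> N F\<close> in the test function plays two roles. Its mean,
  moved to the other side, joins the entropy to form exactly \<open>\<beta> N E\<close>. Inside the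
  exponential, it is the unnormalised density of the modulated Gibbs law, so the moment under the
  tensor power is the partition function times a moment under that law, at most the product of
  \<open>max (exp 1) (Cub \<mu>)\<close> and \<open>Cem \<mu> v\<close>. Division by
  \<open>\<epsilon> N\<close> then produces the rate \<open>\<beta> / \<epsilon>\<close> and the
  error constant. Gauge integrals and estimates of increments take its place, and no sign of the
  free energy is used.\<close>

lemma abs_continuous_on_subset:
  assumes "abs_continuous_on S f" and "S' \<subseteq> S"
  shows "abs_continuous_on S' f"
  unfolding abs_continuous_on_def
proof (intro allI impI)
  fix e :: real assume "e > 0"
  with assms(1) obtain d where "d > 0" and d: "\<forall>(n::nat) a b.
        (\<forall>i<n. a i \<le> b i \<and> {a i..b i} \<subseteq> S) \<and>
        (\<forall>i<n. \<forall>j<n. i \<noteq> j \<longrightarrow> {a i<..<b i} \<inter> {a j<..<b j} = {}) \<and>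
        (\<Sum>i<n. b i - a i) < d \<longrightarrow> (\<Sum>i<n. \<bar>f (b i) - f (a i)\<bar>) < e"
    unfolding abs_continuous_on_def by blast
  show "\<exists>d>0. \<forall>(n::nat) a b.
        (\<forall>i<n. a i \<le> b i \<and> {a i..b i} \<subseteq> S') \<and>
        (\<forall>i<n. \<forall>j<n. i \<noteq> j \<longrightarrow> {a i<..<b i} \<inter> {a j<..<b j} = {}) \<and>
        (\<Sum>i<n. b i - a i) < d \<longrightarrow> (\<Sum>i<n. \<bar>f (b i) - f (a i)\<bar>) < e"
  proof (rule exI[of _ d], intro conjI allI impI)
    fix n :: nat and a b :: "nat \<Rightarrow> real"
    assume "(\<forall>i<n. a i \<le> b i \<and> {a i..b i} \<subseteq> S') \<and>
        (\<forall>i<n. \<forall>j<n. i \<noteq> j \<longrightarrow> {a i<..<b i} \<inter> {a j<..<b j} = {}) \<and> (\<Sum>i<n. b i - a i) < d"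
    then show "(\<Sum>i<n. \<bar>f (b i) - f (a i)\<bar>) < e"
      using assms(2) by (intro d[rule_format]) blast
  qed (fact \<open>d > 0\<close>)
qed

text \<open>The definition numbers the intervals by naturals below \<open>n\<close>, whereas the
  cells of a tagged division come indexed by tag-cell pairs; a bijection with an initial segment
  transfers the smallness.\<close>

lemma abs_continuous_on_finite_family:
  assumes "abs_continuous_on S f" and "e > 0"
  shows "\<exists>d>0. \<forall>(I :: 'i set) l r. finite I \<and> (\<forall>i\<in>I. l i \<le> r i \<and> {l i..r i} \<subseteq> S) \<and>
      disjoint_family_on (\<lambda>i. {l i<..<r i}) I \<and> (\<Sum>i\<in>I. r i - l i) < d
      \<longrightarrow> (\<Sum>i\<in>I. \<bar>f (r i) - f (l i)\<bar>) < e"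
proof -
  obtain d where d: "d > 0" and small: "\<forall>(n::nat) a b.
        (\<forall>i<n. a i \<le> b i \<and> {a i..b i} \<subseteq> S) \<and>
        (\<forall>i<n. \<forall>j<n. i \<noteq> j \<longrightarrow> {a i<..<b i} \<inter> {a j<..<b j} = {}) \<and>
        (\<Sum>i<n. b i - a i) < d \<longrightarrow> (\<Sum>i<n. \<bar>f (b i) - f (a i)\<bar>) < e"
    using assms unfolding abs_continuous_on_def by blast
  show ?thesis
  proof (rule exI[of _ d], intro conjI allI impI, fact d, elim conjE)
    fix I :: "'i set" and l r :: "'i \<Rightarrow> real"
    assume I: "finite I" "\<forall>i\<in>I. l i \<le> r i \<and> {l i..r i} \<subseteq> S"
      "disjoint_family_on (\<lambda>i. {l i<..<r i}) I" "(\<Sum>i\<in>I. r i - l i) < d"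
    obtain h where h: "bij_betw h {..<card I} I"
      using ex_bij_betw_nat_finite[OF I(1)] by (auto simp: atLeast0LessThan)
    have hI: "h i \<in> I" if "i < card I" for i
      using h that by (auto simp: bij_betw_def)
    have dis: "{l (h i)<..<r (h i)} \<inter> {l (h j)<..<r (h j)} = {}"
      if "i < card I" "j < card I" "i \<noteq> j" for i j
    proof -
      have "h i \<noteq> h j"
        using h that by (auto simp: bij_betw_def inj_on_def)
      then show ?thesis
        using I(3) hI that unfolding disjoint_family_on_def by blast
    qed
    have "(\<Sum>i<card I. \<bar>f (r (h i)) - f (l (h i))\<bar>) < e"
      using I(2,4) hI dis sum.reindex_bij_betw[OF h, of "\<lambda>i. r i - l i"]
      by (intro small[rule_format]) auto
    then show "(\<Sum>i\<in>I. \<bar>f (r i) - f (l i)\<bar>) < e"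
      using sum.reindex_bij_betw[OF h, of "\<lambda>i. \<bar>f (r i) - f (l i)\<bar>"] by simp
  qed
qed

lemma abs_continuous_on_imp_continuous_on:
  assumes "abs_continuous_on {a..b} f"
  shows "continuous_on {a..b} f"
  unfolding continuous_on_iff
proof (intro ballI allI impI)
  fix x e :: real assume x: "x \<in> {a..b}" and "e > 0"
  obtain d where d: "d > 0" and small: "\<forall>(I :: nat set) l r. finite I \<and> (\<forall>i\<in>I. l i \<le> r i \<and> {l i..r i} \<subseteq> {a..b}) \<and>
      disjoint_family_on (\<lambda>i. {l i<..<r i}) I \<and> (\<Sum>i\<in>I. r i - l i) < d
      \<longrightarrow> (\<Sum>i\<in>I. \<bar>f (r i) - f (l i)\<bar>) < e"
    using abs_continuous_on_finite_family[OF assms \<open>e > 0\<close>] by blast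
  have "dist (f y) (f x) < e" if "y \<in> {a..b}" "dist y x < d" for y
    using small[rule_format, of "{0}" "\<lambda>_. min x y" "\<lambda>_. max x y"] x that
    by (auto simp: disjoint_family_on_def dist_real_def min_def max_def abs_if split: if_splits)
  with d show "\<exists>d>0. \<forall>y\<in>{a..b}. dist y x < d \<longrightarrow> dist (f y) (f x) < e"
    by blast
qed

text \<open>Neighbouring cells of a division share endpoints, so only their interiors are disjoint;
  these have the same lengths, and additivity of the measure applies to them.\<close>

lemma sum_lengths_le_measure:
  fixes l r :: "'i \<Rightarrow> real"
  assumes "finite I" "\<And>i. i \<in> I \<Longrightarrow> l i \<le> r i" "\<And>i. i \<in> I \<Longrightarrow> {l i<..<r i} \<subseteq> U"
    and "disjoint_family_on (\<lambda>i. {l i<..<r i}) I" and U: "U \<in> lmeasurable"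
  shows "(\<Sum>i\<in>I. r i - l i) \<le> measure lebesgue U"
proof -
  have "ennreal (\<Sum>i\<in>I. r i - l i) = (\<Sum>i\<in>I. emeasure lebesgue {l i<..<r i})"
    using assms(2) by (subst sum_ennreal[symmetric]) auto
  also have "\<dots> = emeasure lebesgue (\<Union>i\<in>I. {l i<..<r i})"
    using assms by (intro sum_emeasure) auto
  also have "\<dots> \<le> emeasure lebesgue U"
    using assms(3) U by (intro emeasure_mono) auto
  also have "\<dots> = ennreal (measure lebesgue U)"
    using U by (simp add: emeasure_eq_measure2)
  finally show ?thesis
    by (simp add: ennreal_le_iff)
qed

text \<open>A gauge controls the increments at tags outside the exceptional set by the derivative; at tags in
  the exceptional set, absolute continuity makes the total increment small.\<close>

lemma abs_continuous_increment_le_integral: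
  fixes F h :: "real \<Rightarrow> real"
  assumes "a \<le> b" and AC: "abs_continuous_on {a..b} F" and h: "h integrable_on {a..b}"
    and Z: "negligible Z"
    and deriv: "\<And>x. x \<in> {a..b} - Z \<Longrightarrow> \<exists>D. (F has_real_derivative D) (at x within {a..b}) \<and> D \<le> h x"
  shows "F b - F a \<le> integral {a..b} h"
proof -
  \<comment> \<open>One \<open>e\<close> is the error of the Riemann sum, one bounds the increments
    over cells tagged in \<open>Z\<close>, and \<open>e * (b - a)\<close> collects the errors of the
    first-order expansions at the other tags.\<close>
  have bound: "F b - F a \<le> integral {a..b} h + e * (2 + (b - a))" if e: "e > 0" for e
  proof -
    \<comment> \<open>Setting \<open>h\<close> to 0 on the negligible set \<open>Z\<close> keeps the
      integral and removes from the Riemann sum the tags at which \<open>h\<close> says nothing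
      about \<open>F\<close>.\<close>
    define k where "k x = (if x \<in> Z then 0 else h x)" for x
    have "(k has_integral integral {a..b} h) {a..b}"
      using integrable_integral[OF h] by (rule has_integral_spike[OF Z, rotated]) (auto simp: k_def)
    then obtain g1 where g1: "gauge g1" and riemann: "\<And>p. p tagged_division_of {a..b} \<Longrightarrow> g1 fine p
        \<Longrightarrow> norm ((\<Sum>(x,K)\<in>p. measure lborel K *\<^sub>R k x) - integral {a..b} h) < e"
      using e unfolding has_integral_real by meson
    obtain d where d: "d > 0" and small: "\<forall>(I :: (real \<times> real set) set) l r. finite I \<and> (\<forall>i\<in>I. l i \<le> r i \<and> {l i..r i} \<subseteq> {a..b}) \<and>
      disjoint_family_on (\<lambda>i. {l i<..<r i}) I \<and> (\<Sum>i\<in>I. r i - l i) < d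
      \<longrightarrow> (\<Sum>i\<in>I. \<bar>F (r i) - F (l i)\<bar>) < e"
      using abs_continuous_on_finite_family[OF AC e] by blast
    have Zm: "Z \<in> lmeasurable" and Z_sets: "Z \<in> sets lebesgue"
      using Z by (auto simp: negligible_iff_null_sets intro: negligible_imp_measurable)
    \<comment> \<open>The threshold \<open>d\<close> is fixed before the gauge: as \<open>Z\<close>
      is null, \<open>U\<close> itself has measure below \<open>d\<close>, so the cells confined to
      \<open>U\<close> have total length below \<open>d\<close>.\<close>
    obtain U where U: "open U" "Z \<subseteq> U" "U - Z \<in> lmeasurable" "emeasure lebesgue (U - Z) < ennreal d"
      using sets_lebesgue_outer_open[OF Z_sets d] by metis
    have Um: "U \<in> lmeasurable"
      using U(2,3) Zm by (metis Diff_partition fmeasurable.Un)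
    have "emeasure lebesgue U = emeasure lebesgue (U - Z)"
      using Z Um by (intro emeasure_Diff_null_set[symmetric]) (auto simp: negligible_iff_null_sets)
    then have U_small: "measure lebesgue U < d"
      using U(4) Um by (metis emeasure_eq_measure2 ennreal_less_iff measure_nonneg)
    have "\<exists>t>0. \<forall>y\<in>{a..b}. \<bar>y - x\<bar> < t \<longrightarrow> \<bar>F y - F x - D * (y - x)\<bar> \<le> e * \<bar>y - x\<bar>"
      if "(F has_real_derivative D) (at x within {a..b})" for x D
      using that e unfolding has_field_derivative_def has_derivative_within_alt by fastforce
    then have "\<exists>t>0. \<exists>D \<le> h x. \<forall>y\<in>{a..b}. \<bar>y - x\<bar> < t \<longrightarrow> \<bar>F y - F x - D * (y - x)\<bar> \<le> e * \<bar>y - x\<bar>"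
      if "x \<in> {a..b} - Z" for x
      using deriv[OF that] by meson
    then obtain t where t: "\<And>x. x \<in> {a..b} - Z \<Longrightarrow> t x > 0 \<and>
        (\<exists>D \<le> h x. \<forall>y\<in>{a..b}. \<bar>y - x\<bar> < t x \<longrightarrow> \<bar>F y - F x - D * (y - x)\<bar> \<le> e * \<bar>y - x\<bar>)"
      by metis
    \<comment> \<open>A fine cell tagged in \<open>Z\<close> lies in \<open>U\<close>; a cell tagged
      elsewhere lies where the expansion at its tag is valid. \<open>UNIV\<close> is a filler, as
      all tags lie in \<open>{a..b}\<close>.\<close>
    define g2 where "g2 x = (if x \<in> Z then U else if x \<in> {a..b} then ball x (t x) else UNIV)" for x
    have "gauge g2"
      using U(1,2) t by (auto simp: gauge_def g2_def)
    then obtain p where p: "p tagged_division_of {a..b}" "(\<lambda>x. g1 x \<inter> g2 x) fine p"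
      using fine_division_exists_real[OF gauge_Int[OF g1]] by metis
    have fine: "g1 fine p" "g2 fine p"
      using p(2) by (auto simp: fine_Int)
    have fin: "finite p"
      using p(1) by (rule tagged_division_of_finite)
    have cell: "\<exists>u v. K = {u..v} \<and> a \<le> u \<and> u \<le> x \<and> x \<le> v \<and> v \<le> b \<and> {u..v} \<subseteq> g2 x"
      if xK: "(x, K) \<in> p" for x K
    proof -
      obtain u v where uv: "K = {u..v}"
        using tagged_division_ofD(4)[OF p(1) xK] by auto
      show ?thesis
        using tagged_division_ofD(2,3)[OF p(1) xK] fineD[OF fine(2) xK] uv
        by (intro exI[of _ u] exI[of _ v]) auto
    qed
    \<comment> \<open>Straddle argument: the tag splits the cell, and the errors of the two halves
      add up to \<open>e * (v - u)\<close>.\<close>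
    have regular: "F (Sup K) - F (Inf K) \<le> measure lborel K *\<^sub>R k x + e * measure lborel K"
      if xK: "(x, K) \<in> p" and xZ: "x \<notin> Z" for x K
    proof -
      obtain u v where uv: "K = {u..v}" "a \<le> u" "u \<le> x" "x \<le> v" "v \<le> b" "{u..v} \<subseteq> g2 x"
        using cell[OF xK] by blast
      then have "{u..v} \<subseteq> ball x (t x)"
        using xZ by (auto simp: g2_def)
      moreover have "u \<in> {u..v}" "v \<in> {u..v}"
        using uv by auto
      ultimately have "u \<in> ball x (t x)" "v \<in> ball x (t x)"
        by blast+
      then have near: "\<bar>u - x\<bar> < t x" "\<bar>v - x\<bar> < t x"
        by (auto simp: dist_real_def abs_minus_commute)
      obtain D where D: "D \<le> h x"
        "\<And>y. y \<in> {a..b} \<Longrightarrow> \<bar>y - x\<bar> < t x \<Longrightarrow> \<bar>F y - F x - D * (y - x)\<bar> \<le> e * \<bar>y - x\<bar>"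
        using t[of x] xZ uv by force
      have "F v - F x \<le> D * (v - x) + e * (v - x)" "F x - F u \<le> D * (x - u) + e * (x - u)"
        using D(2)[of v] D(2)[of u] near uv by (auto simp: algebra_simps)
      then have "F v - F u \<le> D * (v - u) + e * (v - u)"
        by (simp add: algebra_simps)
      also have "\<dots> \<le> h x * (v - u) + e * (v - u)"
        using D(1) uv by (simp add: mult_right_mono)
      finally show ?thesis
        using uv xZ by (simp add: k_def mult.commute)
    qed
    define q where "q = {(x, K) \<in> p. x \<in> Z}"
    have q: "finite q" "q \<subseteq> p"
      using fin by (auto simp: q_def intro: finite_subset)
    have dis: "disjoint_family_on (\<lambda>i. {Inf (snd i)<..<Sup (snd i)}) q"
      unfolding disjoint_family_on_def
    proof (intro ballI impI)
      fix i j assume ij: "i \<in> q" "j \<in> q" "i \<noteq> j"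
      obtain x K y L where xy: "i = (x, K)" "j = (y, L)" "(x, K) \<in> p" "(y, L) \<in> p"
        using ij by (auto simp: q_def)
      obtain u v u' v' where "K = {u..v}" "u \<le> v" "L = {u'..v'}" "u' \<le> v'"
        using cell[OF xy(3)] cell[OF xy(4)] by (metis order_trans)
      then show "{Inf (snd i)<..<Sup (snd i)} \<inter> {Inf (snd j)<..<Sup (snd j)} = {}"
        using tagged_division_ofD(5)[OF p(1) xy(3,4)] ij(3) xy(1,2) by auto
    qed
    have q_cell: "Inf (snd i) \<le> Sup (snd i) \<and> {Inf (snd i)..Sup (snd i)} \<subseteq> {a..b} \<and>
        {Inf (snd i)<..<Sup (snd i)} \<subseteq> U" if i: "i \<in> q" for i
    proof -
      obtain x K where xK: "i = (x, K)" "(x, K) \<in> p" "x \<in> Z"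
        using i by (auto simp: q_def)
      obtain u v where uv: "K = {u..v}" "a \<le> u" "u \<le> x" "x \<le> v" "v \<le> b" "{u..v} \<subseteq> g2 x"
        using cell[OF xK(2)] by blast
      then show ?thesis
        using xK by (auto simp: g2_def)
    qed
    have "(\<Sum>i\<in>q. Sup (snd i) - Inf (snd i)) \<le> measure lebesgue U"
      using q(1) q_cell dis Um by (intro sum_lengths_le_measure) auto
    then have "(\<Sum>i\<in>q. \<bar>F (Sup (snd i)) - F (Inf (snd i))\<bar>) < e"
      using U_small q(1) q_cell dis by (intro small[rule_format]) auto
    moreover have "(\<Sum>(x, K)\<in>q. F (Sup K) - F (Inf K)) \<le> (\<Sum>i\<in>q. \<bar>F (Sup (snd i)) - F (Inf (snd i))\<bar>)"
      by (auto intro!: sum_mono simp: case_prod_beta)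
    ultimately have singular: "(\<Sum>(x, K)\<in>q. F (Sup K) - F (Inf K)) \<le> e"
      by linarith
    have "(\<Sum>(x, K)\<in>p - q. F (Sup K) - F (Inf K)) \<le> (\<Sum>(x, K)\<in>p - q. measure lborel K *\<^sub>R k x + e * measure lborel K)"
      using regular by (intro sum_mono) (auto simp: q_def)
    \<comment> \<open>Returning to the whole division adds only nonnegative terms, because
      \<open>k\<close> vanishes at tags in \<open>Z\<close>.\<close>
    also have "\<dots> \<le> (\<Sum>(x, K)\<in>p. measure lborel K *\<^sub>R k x + e * measure lborel K)"
      using fin e by (intro sum_mono2) (auto simp: q_def k_def)
    also have "\<dots> = (\<Sum>(x, K)\<in>p. measure lborel K *\<^sub>R k x) + e * (\<Sum>(x, K)\<in>p. measure lborel K)"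
      by (simp add: case_prod_beta sum.distrib sum_distrib_left)
    also have "(\<Sum>(x, K)\<in>p. measure lborel K) = b - a"
      using additive_content_tagged_division[of p a b] p(1) \<open>a \<le> b\<close> by (simp add: box_real)
    finally have "(\<Sum>(x, K)\<in>p - q. F (Sup K) - F (Inf K)) \<le> integral {a..b} h + e + e * (b - a)"
      using riemann[OF p(1) fine(1)] by (simp add: abs_less_iff)
    moreover have "F b - F a = (\<Sum>(x, K)\<in>p - q. F (Sup K) - F (Inf K)) + (\<Sum>(x, K)\<in>q. F (Sup K) - F (Inf K))"
      using additive_tagged_division_1[OF \<open>a \<le> b\<close> p(1), of F] sum.subset_diff[OF q(2) fin] by metis
    ultimately show ?thesis
      using singular by (simp add: algebra_simps)
  qed
  show ?thesis
  proof (rule field_le_epsilon)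
    fix e :: real assume "e > 0"
    moreover have "2 + (b - a) > 0"
      using \<open>a \<le> b\<close> by simp
    ultimately show "F b - F a \<le> integral {a..b} h + e"
      using bound[of "e / (2 + (b - a))"] by simp
  qed
qed

section \<open>Gronwall inequality with an integrable rate\<close>

text \<open>Together with \<open>1 + x \<le> exp x\<close> this bounds the linearisation error of
  the integrating factor by \<open>x\<^sup>2\<close>, whatever the sign of \<open>x\<close>. For
  \<open>x = - y < 0\<close>, the quadratic Taylor polynomial bounds \<open>exp y\<close> from
  below, and its product with \<open>1 - y + y\<^sup>2\<close> has constant term 1 and no negative
  coefficient.\<close>

lemma exp_le_quadratic:
  fixes x :: real
  assumes "\<bar>x\<bar> \<le> 1"
  shows "exp x \<le> 1 + x + x\<^sup>2"
proof (cases "0 \<le> x")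
  case True
  then show ?thesis using assms exp_bound[of x] by simp
next
  case False
  define y where "y = - x"
  have y: "0 \<le> y" "y \<le> 1"
    using False assms by (auto simp: y_def)
  have "1 \<le> (1 + y + y\<^sup>2 / 2) * (1 - y + y\<^sup>2)"
  proof -
    have "(1 + y + y\<^sup>2 / 2) * (1 - y + y\<^sup>2) = 1 + y\<^sup>2 / 2 + y ^ 3 / 2 + y ^ 4 / 2"
      by (simp add: field_simps power2_eq_square power3_eq_cube power4_eq_xxxx)
    then show ?thesis using y by simp
  qed
  also have "\<dots> \<le> exp y * (1 - y + y\<^sup>2)"
    using exp_lower_Taylor_quadratic[OF y(1)] y by (intro mult_right_mono) auto
  finally show ?thesis
    by (simp add: y_def exp_minus field_simps)
qed

text \<open>Inequalities between increments add up over adjacent intervals, so they pass from a fine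
  subdivision to the whole interval. The step is \<open>d / 2\<close> because \<open>short\<close>
  asks for a length strictly below \<open>d\<close>.\<close>

lemma increment_le_of_short_increments:
  fixes \<Phi> M :: "real \<Rightarrow> real"
  assumes "a \<le> b" "d > 0"
    and short: "\<And>u v. a \<le> u \<Longrightarrow> u \<le> v \<Longrightarrow> v \<le> b \<Longrightarrow> v - u < d \<Longrightarrow> \<Phi> v - \<Phi> u \<le> M v - M u"
  shows "\<Phi> b - \<Phi> a \<le> M b - M a"
proof -
  have "\<Phi> v - \<Phi> a \<le> M v - M a" if "a \<le> v" "v \<le> b" "v - a \<le> real n * (d / 2)" for n v
    using that
  proof (induction n arbitrary: v)
    case 0
    then show ?case by simp
  next
    case (Suc n)
    define u where "u = max a (v - d / 2)"
    have "\<Phi> u - \<Phi> a \<le> M u - M a"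
      using Suc.prems \<open>d > 0\<close> by (intro Suc.IH) (auto simp: u_def max_def algebra_simps)
    moreover have "\<Phi> v - \<Phi> u \<le> M v - M u"
      using Suc.prems \<open>d > 0\<close> by (intro short) (auto simp: u_def max_def)
    ultimately show ?case by linarith
  qed
  moreover obtain n where "b - a \<le> real n * (d / 2)"
    using reals_Archimedean3[of "d / 2"] \<open>d > 0\<close> by (meson half_gt_zero less_imp_le)
  ultimately show ?thesis
    using \<open>a \<le> b\<close> by blast
qed

lemma absolutely_integrable_mult_continuous:
  fixes f g :: "real \<Rightarrow> real"
  assumes "continuous_on {a..b} f" and "g absolutely_integrable_on {a..b}"
  shows "(\<lambda>x. f x * g x) absolutely_integrable_on {a..b}"
  using assms
  by (intro absolutely_integrable_bounded_measurable_product_real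
      continuous_imp_measurable_on_sets_lebesgue compact_imp_bounded compact_continuous_image) auto

text \<open>On short intervals the increment of \<open>w E\<close>, \<open>w\<close> the integrating factor, exceeds \<open>\<integral> w g\<close> by at most a small
  multiple of \<open>\<integral> (\<bar>c\<bar> + \<bar>g\<bar>)\<close>. Working with increments avoids differentiating the primitive of \<open>c\<close>.\<close>

lemma gronwall_integral:
  fixes E c g :: "real \<Rightarrow> real"
  assumes "a \<le> b" and contE: "continuous_on {a..b} E"
    and c: "c absolutely_integrable_on {a..b}" and g: "g absolutely_integrable_on {a..b}"
    and step: "\<And>u v. a \<le> u \<Longrightarrow> u \<le> v \<Longrightarrow> v \<le> b \<Longrightarrow>
        E v - E u \<le> integral {u..v} (\<lambda>r. c r * E r + g r)"
  shows "E b \<le> exp (integral {a..b} c) * E a + integral {a..b} (\<lambda>r. exp (integral {r..b} c) * g r)"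
proof -
  \<comment> \<open>Integrating up to \<open>b\<close> rather than from \<open>a\<close> gives
    \<open>w b = 1\<close> and \<open>w a = exp (integral {a..b} c)\<close>, the coefficients of the
    conclusion.\<close>
  define J where "J r = integral {r..b} c" for r
  define w where "w r = exp (J r)" for r
  define m where "m r = \<bar>c r\<bar> + \<bar>g r\<bar>" for r
  have ci: "c integrable_on {a..b}" and gi: "g integrable_on {a..b}"
    using c g by (auto intro: set_lebesgue_integral_eq_integral(1))
  have abs_ci: "(\<lambda>r. \<bar>c r\<bar>) integrable_on {a..b}" and abs_gi: "(\<lambda>r. \<bar>g r\<bar>) integrable_on {a..b}"
    using c g by (auto simp: absolutely_integrable_on_def)
  have contJ: "continuous_on {a..b} J"
    unfolding J_def by (rule indefinite_integral_continuous_1'[OF ci])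
  then have contw: "continuous_on {a..b} w"
    unfolding w_def by (intro continuous_intros)
  have wgi: "(\<lambda>r. w r * g r) integrable_on {a..b}" and cEi: "(\<lambda>r. c r * E r) integrable_on {a..b}"
    using absolutely_integrable_mult_continuous[OF contw g] absolutely_integrable_mult_continuous[OF contE c]
    by (auto simp: absolutely_integrable_on_def mult.commute)
  have mi: "m integrable_on {a..b}"
    unfolding m_def using abs_ci abs_gi by (rule integrable_add)
  obtain B where B: "B \<ge> 1" "\<And>r. r \<in> {a..b} \<Longrightarrow> \<bar>E r\<bar> \<le> B" "\<And>r. r \<in> {a..b} \<Longrightarrow> w r \<le> B"
  proof -
    have "bounded (E ` {a..b})" "bounded (w ` {a..b})"
      using contE contw by (auto intro!: compact_imp_bounded compact_continuous_image)
    then obtain B1 B2 where "\<forall>r\<in>{a..b}. \<bar>E r\<bar> \<le> B1" "\<forall>r\<in>{a..b}. \<bar>w r\<bar> \<le> B2"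
      unfolding bounded_iff by auto
    then show thesis
      by (intro that[of "max 1 (max B1 B2)"]) force+
  qed
  \<comment> \<open>On a short interval the error is at most \<open>(B\<^sup>2 + B) * e\<close>
    times the integral of \<open>\<bar>c\<bar>\<close> plus \<open>e\<close> times that of
    \<open>\<bar>g\<bar>\<close>; \<open>B\<^sup>2 + B + 1\<close> dominates both coefficients. The
    restriction \<open>e \<le> 1\<close> serves \<open>exp_le_quadratic\<close>.\<close>
  have main: "w b * E b - w a * E a - integral {a..b} (\<lambda>r. w r * g r) \<le> (B\<^sup>2 + B + 1) * e * integral {a..b} m"
    if e: "0 < e" "e \<le> 1" for e
  proof -
    have unif: "\<exists>d>0. \<forall>u\<in>{a..b}. \<forall>v\<in>{a..b}. \<bar>v - u\<bar> < d \<longrightarrow> \<bar>h v - h u\<bar> < e"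
      if "continuous_on {a..b} h" for h :: "real \<Rightarrow> real"
      using compact_uniformly_continuous[OF that] e by (auto simp: uniformly_continuous_on_def dist_real_def)
    obtain d1 where d1: "d1 > 0" "\<forall>u\<in>{a..b}. \<forall>v\<in>{a..b}. \<bar>v - u\<bar> < d1 \<longrightarrow> \<bar>E v - E u\<bar> < e"
      using unif[OF contE] by blast
    obtain d2 where d2: "d2 > 0" "\<forall>u\<in>{a..b}. \<forall>v\<in>{a..b}. \<bar>v - u\<bar> < d2 \<longrightarrow> \<bar>w v - w u\<bar> < e"
      using unif[OF contw] by blast
    \<comment> \<open>Uniform continuity of \<open>J\<close> makes the integral
      \<open>\<delta>\<close> of \<open>c\<close> over a short interval at most \<open>e\<close>,
      even where \<open>c\<close> is unbounded; hence \<open>\<delta>\<^sup>2\<close> is at most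
      \<open>e\<close> times the integral of \<open>\<bar>c\<bar>\<close>.\<close>
    obtain d3 where d3: "d3 > 0" "\<forall>u\<in>{a..b}. \<forall>v\<in>{a..b}. \<bar>v - u\<bar> < d3 \<longrightarrow> \<bar>J v - J u\<bar> < e"
      using unif[OF contJ] by blast
    define d where "d = min d1 (min d2 d3)"
    have short: "w v * E v - w u * E u \<le> integral {u..v} (\<lambda>r. w r * g r) + (B\<^sup>2 + B + 1) * e * integral {u..v} m"
      if uv: "a \<le> u" "u \<le> v" "v \<le> b" "v - u < d" for u v
    proof -
      have sub: "{u..v} \<subseteq> {a..b}" using uv by auto
      note on_sub = integrable_on_subinterval[OF _ sub]
      have near: "\<bar>E r - E u\<bar> \<le> e" "\<bar>w v - w r\<bar> \<le> e" if "r \<in> {u..v}" for r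
        using d1(2) d2(2) uv that by (auto simp: d_def intro!: less_imp_le)
      define \<delta> where "\<delta> = integral {u..v} c"
      have Juv: "J u = \<delta> + J v"
        unfolding J_def \<delta>_def
        using uv Henstock_Kurzweil_Integration.integral_combine[of u v b c] integrable_on_subinterval[OF ci, of u b] by auto
      have "\<bar>J v - J u\<bar> < e"
        using d3(2) uv by (auto simp: d_def)
      then have \<delta>: "\<bar>\<delta>\<bar> \<le> e"
        using Juv by simp
      have \<delta>_le: "\<bar>\<delta>\<bar> \<le> integral {u..v} (\<lambda>r. \<bar>c r\<bar>)"
        unfolding \<delta>_def using integral_norm_bound_integral[OF on_sub[OF ci] on_sub[OF abs_ci]] by simp
      have ints: "integral {u..v} (\<lambda>r. \<bar>c r\<bar>) \<ge> 0" "integral {u..v} (\<lambda>r. \<bar>g r\<bar>) \<ge> 0"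
        "integral {u..v} m = integral {u..v} (\<lambda>r. \<bar>c r\<bar>) + integral {u..v} (\<lambda>r. \<bar>g r\<bar>)"
        unfolding m_def using on_sub[OF abs_ci] on_sub[OF abs_gi] by (auto intro: integral_nonneg integral_add)
      have wuv: "w u = w v * exp \<delta>"
        unfolding w_def Juv by (simp add: exp_add)
      have wv: "0 < w v" "w v \<le> B" and Eu: "\<bar>E u\<bar> \<le> B"
        using B uv by (auto simp: w_def)
      have "integral {u..v} (\<lambda>r. c r * E r) \<le> integral {u..v} (\<lambda>r. E u * c r + e * \<bar>c r\<bar>)"
      proof (rule integral_le)
        show "(\<lambda>r. c r * E r) integrable_on {u..v}" by (rule on_sub[OF cEi])
        show "(\<lambda>r. E u * c r + e * \<bar>c r\<bar>) integrable_on {u..v}"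
          using on_sub[OF ci] on_sub[OF abs_ci] by (intro integrable_add integrable_on_mult_right) auto
        fix r assume "r \<in> {u..v}"
        then have "\<bar>c r * (E r - E u)\<bar> \<le> \<bar>c r\<bar> * e"
          unfolding abs_mult using near by (intro mult_left_mono) auto
        then show "c r * E r \<le> E u * c r + e * \<bar>c r\<bar>"
          by (simp add: algebra_simps abs_le_iff)
      qed
      also have "\<dots> = E u * \<delta> + e * integral {u..v} (\<lambda>r. \<bar>c r\<bar>)"
        unfolding \<delta>_def using on_sub[OF ci] on_sub[OF abs_ci]
        by (subst integral_add) (auto intro!: integrable_on_mult_right)
      finally have drift: "integral {u..v} (\<lambda>r. c r * E r) \<le> E u * \<delta> + e * integral {u..v} (\<lambda>r. \<bar>c r\<bar>)" .
      have "integral {u..v} (\<lambda>r. w v * g r) \<le> integral {u..v} (\<lambda>r. w r * g r + e * \<bar>g r\<bar>)"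
      proof (rule integral_le)
        show "(\<lambda>r. w v * g r) integrable_on {u..v}"
          using on_sub[OF gi] by (rule integrable_on_mult_right)
        show "(\<lambda>r. w r * g r + e * \<bar>g r\<bar>) integrable_on {u..v}"
          using on_sub[OF wgi] on_sub[OF abs_gi] by (intro integrable_add integrable_on_mult_right) auto
        fix r assume "r \<in> {u..v}"
        then have "\<bar>(w v - w r) * g r\<bar> \<le> e * \<bar>g r\<bar>"
          unfolding abs_mult using near by (intro mult_right_mono) auto
        then show "w v * g r \<le> w r * g r + e * \<bar>g r\<bar>"
          by (simp add: algebra_simps abs_le_iff)
      qed
      also have "\<dots> = integral {u..v} (\<lambda>r. w r * g r) + e * integral {u..v} (\<lambda>r. \<bar>g r\<bar>)"
        using on_sub[OF wgi] on_sub[OF abs_gi]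
        by (subst integral_add) (auto intro!: integrable_on_mult_right)
      finally have source: "w v * integral {u..v} g \<le> integral {u..v} (\<lambda>r. w r * g r) + e * integral {u..v} (\<lambda>r. \<bar>g r\<bar>)"
        by simp
      have taylor: "\<bar>1 + \<delta> - exp \<delta>\<bar> \<le> \<delta>\<^sup>2"
        using exp_le_quadratic[of \<delta>] exp_ge_add_one_self[of \<delta>] \<delta> e by auto
      have "E u * (1 + \<delta> - exp \<delta>) \<le> \<bar>E u\<bar> * \<bar>1 + \<delta> - exp \<delta>\<bar>"
        by (metis abs_ge_self abs_mult)
      also have "\<dots> \<le> B * (e * integral {u..v} (\<lambda>r. \<bar>c r\<bar>))"
      proof (rule mult_mono)
        have "\<delta>\<^sup>2 = \<bar>\<delta>\<bar> * \<bar>\<delta>\<bar>" by (simp add: power2_eq_square)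
        also have "\<dots> \<le> e * integral {u..v} (\<lambda>r. \<bar>c r\<bar>)"
          using \<delta> \<delta>_le e by (intro mult_mono) auto
        finally show "\<bar>1 + \<delta> - exp \<delta>\<bar> \<le> e * integral {u..v} (\<lambda>r. \<bar>c r\<bar>)"
          using taylor by linarith
      qed (use Eu B in auto)
      finally have remainder: "E u * (1 + \<delta> - exp \<delta>) \<le> B * e * integral {u..v} (\<lambda>r. \<bar>c r\<bar>)"
        by (simp add: mult.assoc)
      have "E v - E u \<le> integral {u..v} (\<lambda>r. c r * E r) + integral {u..v} g"
        using step[OF uv(1-3)] integral_add[OF on_sub[OF cEi] on_sub[OF gi]] by simp
      \<comment> \<open>\<open>exp \<delta>\<close> replaces \<open>1 + \<delta>\<close> to match
        \<open>w u = w v * exp \<delta>\<close>: multiplication by \<open>w v\<close> then yields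
        the increment of \<open>w E\<close>.\<close>
      with drift have "E v - exp \<delta> * E u \<le> E u * (1 + \<delta> - exp \<delta>) + e * integral {u..v} (\<lambda>r. \<bar>c r\<bar>) + integral {u..v} g"
        by (simp add: algebra_simps)
      with remainder have "E v - exp \<delta> * E u \<le> (B * e + e) * integral {u..v} (\<lambda>r. \<bar>c r\<bar>) + integral {u..v} g"
        by (simp add: algebra_simps)
      then have "w v * (E v - exp \<delta> * E u) \<le> w v * ((B * e + e) * integral {u..v} (\<lambda>r. \<bar>c r\<bar>) + integral {u..v} g)"
        using wv by (intro mult_left_mono) auto
      also have "\<dots> = w v * ((B * e + e) * integral {u..v} (\<lambda>r. \<bar>c r\<bar>)) + w v * integral {u..v} g"
        by (simp add: algebra_simps)
      also have "w v * ((B * e + e) * integral {u..v} (\<lambda>r. \<bar>c r\<bar>)) \<le> B * ((B * e + e) * integral {u..v} (\<lambda>r. \<bar>c r\<bar>))"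
        using wv B(1) e ints by (intro mult_right_mono) auto
      finally have "w v * E v - w u * E u
          \<le> B * ((B * e + e) * integral {u..v} (\<lambda>r. \<bar>c r\<bar>)) + w v * integral {u..v} g"
        unfolding wuv by (simp add: algebra_simps)
      also have "\<dots> \<le> B * ((B * e + e) * integral {u..v} (\<lambda>r. \<bar>c r\<bar>))
          + (integral {u..v} (\<lambda>r. w r * g r) + e * integral {u..v} (\<lambda>r. \<bar>g r\<bar>))"
        using source by simp
      also have "\<dots> \<le> integral {u..v} (\<lambda>r. w r * g r) + (B\<^sup>2 + B + 1) * e * integral {u..v} m"
      proof -
        have "0 \<le> (B\<^sup>2 + B) * (e * integral {u..v} (\<lambda>r. \<bar>g r\<bar>)) + e * integral {u..v} (\<lambda>r. \<bar>c r\<bar>)"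
          using B(1) e ints by (intro add_nonneg_nonneg mult_nonneg_nonneg) auto
        then show ?thesis
          unfolding ints(3) by (simp add: algebra_simps power2_eq_square)
      qed
      finally show ?thesis .
    qed
    define G where "G r = w r * E r - integral {a..r} (\<lambda>r. w r * g r)" for r
    define M where "M r = (B\<^sup>2 + B + 1) * e * integral {a..r} m" for r
    have "G b - G a \<le> M b - M a"
    proof (rule increment_le_of_short_increments[OF \<open>a \<le> b\<close>, of d])
      show "d > 0" using d1 d2 d3 by (auto simp: d_def)
      fix u v assume uv: "a \<le> u" "u \<le> v" "v \<le> b" "v - u < d"
      have "integral {a..u} f + integral {u..v} f = integral {a..v} f" if "f integrable_on {a..b}" for f :: "real \<Rightarrow> real"
        using uv integrable_on_subinterval[OF that, of a v] by (intro Henstock_Kurzweil_Integration.integral_combine) auto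
      note split = this[OF wgi] this[OF mi]
      show "G v - G u \<le> M v - M u"
        unfolding G_def M_def split[symmetric] using short[OF uv] by (simp add: algebra_simps)
    qed
    then show ?thesis
      by (simp add: G_def M_def)
  qed
  have wb: "w b = 1"
    by (simp add: w_def J_def)
  have "w b * E b - w a * E a - integral {a..b} (\<lambda>r. w r * g r) \<le> 0"
  proof (rule field_le_epsilon)
    fix e :: real assume e: "e > 0"
    \<comment> \<open>The summand 1 keeps \<open>K\<close> positive, so that \<open>e / K\<close> is
      meaningful; the minimum with 1 below respects the restriction in \<open>main\<close>.\<close>
    define K where "K = (B\<^sup>2 + B + 1) * integral {a..b} m + 1"
    have K: "K \<ge> 1"
      using B(1) mi by (auto simp: K_def m_def intro!: mult_nonneg_nonneg integral_nonneg add_nonneg_nonneg)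
    define e' where "e' = min 1 (e / K)"
    have "e' * (K - 1) \<le> (e / K) * K"
      using K e by (intro mult_mono) (auto simp: e'_def)
    then have "e' * (K - 1) \<le> e" using K by simp
    moreover have "0 < e'" "e' \<le> 1" using K e by (auto simp: e'_def)
    ultimately show "w b * E b - w a * E a - integral {a..b} (\<lambda>r. w r * g r) \<le> 0 + e"
      using main[of e'] by (simp add: K_def algebra_simps)
  qed
  then show ?thesis
    using wb by (simp add: w_def J_def)
qed

text \<open>The pointwise inequality becomes the hypothesis \<open>step\<close> of
  \<open>gronwall_integral\<close> on each subinterval, with integrand \<open>c E + g\<close>. This
  integrand is integrable because \<open>E\<close> is continuous on a compact interval.\<close>

lemma gronwall_abs_continuous:
  fixes E c g :: "real \<Rightarrow> real"
  assumes "a \<le> b" and AC: "abs_continuous_on {a..b} E"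
    and c: "c absolutely_integrable_on {a..b}" and g: "g absolutely_integrable_on {a..b}"
    and deriv: "AE t in lborel. a < t \<and> t < b \<longrightarrow> (\<exists>D. (E has_real_derivative D) (at t) \<and> D \<le> c t * E t + g t)"
  shows "E b \<le> exp (integral {a..b} c) * E a + integral {a..b} (\<lambda>r. exp (integral {r..b} c) * g r)"
proof (rule gronwall_integral[OF \<open>a \<le> b\<close> _ c g])
  show contE: "continuous_on {a..b} E"
    by (rule abs_continuous_on_imp_continuous_on[OF AC])
  obtain N where N: "N \<in> null_sets lborel"
    "{t. \<not> (a < t \<and> t < b \<longrightarrow> (\<exists>D. (E has_real_derivative D) (at t) \<and> D \<le> c t * E t + g t))} \<subseteq> N"
    using deriv by (auto elim!: AE_E simp: null_sets_def)
  \<comment> \<open>Derivatives are known only strictly between \<open>a\<close> and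
    \<open>b\<close>, so the endpoints join the exceptional set.\<close>
  define Z where "Z = N \<union> {a, b}"
  have Z: "negligible Z"
    using N(1) by (auto simp: Z_def negligible_iff_null_sets null_sets_completionI)
  have "(\<lambda>r. E r * c r) absolutely_integrable_on {a..b}"
    by (rule absolutely_integrable_mult_continuous[OF contE c])
  then have hi: "(\<lambda>r. c r * E r + g r) integrable_on {a..b}"
    using g by (auto simp: absolutely_integrable_on_def mult.commute intro!: integrable_add)
  fix u v assume uv: "a \<le> u" "u \<le> v" "v \<le> b"
  show "E v - E u \<le> integral {u..v} (\<lambda>r. c r * E r + g r)"
  proof (rule abs_continuous_increment_le_integral[OF uv(2) _ _ Z])
    show "abs_continuous_on {u..v} E"
      using AC uv by (auto intro: abs_continuous_on_subset)
    show "(\<lambda>r. c r * E r + g r) integrable_on {u..v}"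
      using hi uv by (auto intro: integrable_on_subinterval)
    show "\<exists>D. (E has_real_derivative D) (at x within {u..v}) \<and> D \<le> c x * E x + g x"
      if "x \<in> {u..v} - Z" for x
    proof -
      have "a < x" "x < b" "x \<notin> N"
        using that uv by (auto simp: Z_def order.strict_iff_order)
      then obtain D where "(E has_real_derivative D) (at x)" "D \<le> c x * E x + g x"
        using N(2) by blast
      then show ?thesis
        using has_field_derivative_at_within by blast
    qed
  qed
qed

section \<open>Entropy inequality for the commutator\<close>

text \<open>This is the Gibbs (Donsker-Varadhan) variational inequality. For
  \<open>Y = \<phi> - L - ln C\<close>, with \<open>L\<close> the log-density of \<open>P\<close>,
  the \<open>P\<close>-mean of \<open>exp Y\<close> is at most 1; averaging
  \<open>1 + Y \<le> exp Y\<close> then makes the mean of \<open>Y\<close> nonpositive.\<close>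

lemma integral_le_KL_divergence_plus_ln:
  fixes \<phi> :: "'b \<Rightarrow> real"
  assumes M: "prob_space M" and P: "prob_space P" and sets: "sets P = sets M"
    and ac: "absolutely_continuous M P"
    and ent: "integrable P (entropy_density (exp 1) M P)" and \<phi>: "integrable P \<phi>"
    and moment: "(\<integral>\<^sup>+x. ennreal (exp (\<phi> x)) \<partial>M) \<le> ennreal C" and C: "C > 0"
  shows "(\<integral>x. \<phi> x \<partial>P) \<le> KL_divergence (exp 1) M P + ln C"
proof -
  interpret M: prob_space M by (rule M)
  interpret P: prob_space P by (rule P)
  define L where "L = entropy_density (exp 1) M P"
  define Y where "Y x = \<phi> x - L x - ln C" for x
  have L_eq: "L x = ln (enn2real (RN_deriv M P x))" for x
    by (simp add: L_def entropy_density_def log_def)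
  have meas [measurable]: "\<phi> \<in> borel_measurable M" "L \<in> borel_measurable M"
    using \<phi> ent measurable_cong_sets[OF sets refl] by (auto simp: L_def)
  have Y_int: "integrable P Y"
    unfolding Y_def[abs_def] L_def using \<phi> ent by simp
  have Y_meas [measurable]: "Y \<in> borel_measurable M"
    unfolding Y_def by measurable
  have "(\<integral>\<^sup>+x. ennreal (exp (Y x)) \<partial>P) = (\<integral>\<^sup>+x. ennreal (exp (Y x)) \<partial>density M (RN_deriv M P))"
    using M.density_RN_deriv[OF ac sets] by simp
  also have "\<dots> = (\<integral>\<^sup>+x. RN_deriv M P x * ennreal (exp (Y x)) \<partial>M)"
    by (intro nn_integral_density) auto
  \<comment> \<open>Only an inequality: where the density of \<open>P\<close> vanishes, the left
    integrand is 0 and the right one is positive. Elsewhere the density cancels against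
    \<open>exp (- L x)\<close>.\<close>
  also have "\<dots> \<le> (\<integral>\<^sup>+x. ennreal (exp (\<phi> x)) * ennreal (1 / C) \<partial>M)"
  proof (rule nn_integral_mono_AE)
    have "AE x in M. RN_deriv M P x \<noteq> \<infinity>"
      using P.sigma_finite_measure_axioms ac sets by (rule M.RN_deriv_finite)
    then show "AE x in M. RN_deriv M P x * ennreal (exp (Y x)) \<le> ennreal (exp (\<phi> x)) * ennreal (1 / C)"
    proof eventually_elim
      case (elim x)
      define q where "q = enn2real (RN_deriv M P x)"
      have q: "RN_deriv M P x = ennreal q" "q \<ge> 0"
        using elim by (auto simp: q_def less_top)
      show ?case
      proof (cases "q = 0")
        case True
        then show ?thesis by (simp add: q)
      next
        case False
        then have "q * exp (Y x) = exp (\<phi> x) * (1 / C)"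
          using q(2) C by (simp add: Y_def L_eq q_def[symmetric] exp_diff)
        then show ?thesis
          using q C by (simp add: ennreal_mult[symmetric])
      qed
    qed
  qed
  also have "\<dots> = (\<integral>\<^sup>+x. ennreal (exp (\<phi> x)) \<partial>M) * ennreal (1 / C)"
    by (rule nn_integral_multc) measurable
  also have "\<dots> \<le> ennreal C * ennreal (1 / C)"
    using moment by (intro mult_right_mono) auto
  also have "\<dots> = 1"
    using C by (simp add: ennreal_mult[symmetric])
  finally have le1: "(\<integral>\<^sup>+x. ennreal (exp (Y x)) \<partial>P) \<le> 1" .
  have Y_P [measurable]: "Y \<in> borel_measurable P"
    using Y_int by auto
  have exp_int: "integrable P (\<lambda>x. exp (Y x))"
    using le1 by (intro integrableI_nonneg) (auto simp: le_less_trans)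
  have "ennreal (\<integral>x. exp (Y x) \<partial>P) \<le> 1"
    using le1 exp_int by (subst nn_integral_eq_integral[symmetric]) auto
  then have "(\<integral>x. exp (Y x) \<partial>P) \<le> 1"
    by simp
  moreover have "(\<integral>x. 1 + Y x \<partial>P) \<le> (\<integral>x. exp (Y x) \<partial>P)"
    using Y_int exp_int by (intro integral_mono) auto
  moreover have "(\<integral>x. 1 + Y x \<partial>P) = 1 + (\<integral>x. Y x \<partial>P)"
    using Y_int by (simp add: P.prob_space)
  ultimately have "(\<integral>x. Y x \<partial>P) \<le> 0"
    by simp
  moreover have "(\<integral>x. Y x \<partial>P) = (\<integral>x. \<phi> x \<partial>P) - (\<integral>x. L x \<partial>P) - ln C"
    using \<phi> ent by (simp add: Y_def L_def P.prob_space)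
  ultimately show ?thesis
    by (simp add: KL_divergence_def L_def)
qed

section \<open>Gradient of the kernel and measurability in the configuration\<close>

text \<open>The explicit formula makes the commutator kernel visibly measurable off the diagonal.
  Both cases of \<open>riesz\<close> have radial derivative \<open>- (r powr (- s - 1))\<close>, and
  \<open>sgn x\<close> contributes the remaining power of the norm.\<close>

lemma grad_riesz:
  fixes x :: "'a::euclidean_space"
  assumes "x \<noteq> 0"
  shows "grad (riesz s) x = - (norm x powr (- s - 2)) *\<^sub>R x"
proof -
  define \<psi> where "\<psi> r = (if s = 0 then - ln r else (1 / s) * r powr (- s))" for r :: real
  have r: "norm x > 0" using assms by simp
  have "(\<psi> has_real_derivative - (norm x powr (- s - 1))) (at (norm x))"
  proof (cases "s = 0")
    case True
    then have "\<psi> = (\<lambda>r. - ln r)" by (simp add: \<psi>_def fun_eq_iff)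
    moreover have "((\<lambda>r. - ln r) has_real_derivative - (norm x powr (- s - 1))) (at (norm x))"
      using r True by (auto intro!: derivative_eq_intros simp: powr_minus_divide)
    ultimately show ?thesis by simp
  next
    case False
    then have "\<psi> = (\<lambda>r. (1 / s) * r powr (- s))" by (simp add: \<psi>_def fun_eq_iff)
    moreover have "((\<lambda>r. (1 / s) * r powr (- s)) has_real_derivative - (norm x powr (- s - 1))) (at (norm x))"
      using r False by (auto intro!: derivative_eq_intros simp: field_simps)
    ultimately show ?thesis by simp
  qed
  then have "(\<psi> has_derivative (*) (- (norm x powr (- s - 1)))) (at (norm x))"
    by (simp add: has_field_derivative_def)
  then have "((\<lambda>y. \<psi> (norm y)) has_derivative (\<lambda>h. - (norm x powr (- s - 1)) * (h \<bullet> sgn x))) (at x)"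
    by (rule has_derivative_compose[OF has_derivative_norm[OF assms]])
  moreover have "(\<lambda>y :: 'a. \<psi> (norm y)) = riesz s"
    by (simp add: fun_eq_iff riesz_def \<psi>_def)
  ultimately have "(riesz s has_derivative (\<lambda>h. - (norm x powr (- s - 1)) * (h \<bullet> sgn x))) (at x)"
    by (simp only:)
  then have "frechet_derivative (riesz s) (at x) = (\<lambda>h. - (norm x powr (- s - 1)) * (h \<bullet> sgn x))"
    by (rule frechet_derivative_at[symmetric])
  moreover have "norm x powr (- s - 2) = norm x powr (- s - 1) / norm x"
    using r by (simp add: powr_diff powr_numeral power2_eq_square)
  ultimately have "partial_deriv b (riesz s) x = - (norm x powr (- s - 2)) * (x \<bullet> b)" for b
    by (simp add: partial_deriv_def sgn_div_norm inner_commute divide_inverse)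
  then have "grad (riesz s) x = - (norm x powr (- s - 2)) *\<^sub>R (\<Sum>b\<in>Basis. (x \<bullet> b) *\<^sub>R b)"
    unfolding grad_def by (simp add: scaleR_sum_right)
  then show ?thesis
    by (simp add: euclidean_representation)
qed

lemma borel_measurable_riesz [measurable]: "riesz s \<in> borel_measurable borel"
  unfolding riesz_def by measurable

lemma borel_prob_in_subprob_algebra: "borel_prob \<mu> \<Longrightarrow> \<mu> \<in> space (subprob_algebra borel)"
  by (auto simp: borel_prob_def space_subprob_algebra prob_space_imp_subprob_space)

lemma borel_measurable_potential:
  assumes "borel_prob \<mu>"
  shows "potential s \<mu> \<in> borel_measurable borel"
proof -
  interpret prob_space \<mu> using assms by (simp add: borel_prob_def)
  have [measurable_cong]: "sets \<mu> = sets borel" using assms by (simp add: borel_prob_def)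
  show ?thesis
    unfolding potential_def by measurable
qed

lemma borel_measurable_mod_energy:
  assumes "borel_prob \<mu>"
  shows "(\<lambda>X. mod_energy s N X \<mu>) \<in> borel_measurable (PiM {..<N} (\<lambda>_. borel))"
proof -
  note [measurable] = borel_measurable_potential[OF assms]
  show ?thesis
    unfolding mod_energy_def centered_kernel_def by measurable
qed

text \<open>The commutator depends on the configuration only through this random measure. Viewing it
  as a kernel reduces measurability to that of product measures and integrals as functions of the
  measure. \<open>N \<ge> 1\<close> makes the uniform law on the indices a probability
  measure.\<close>

lemma measurable_empirical:
  assumes "N \<ge> 1"
  shows "empirical N \<in> PiM {..<N} (\<lambda>_. borel :: 'a::euclidean_space measure) \<rightarrow>\<^sub>M subprob_algebra borel"
  unfolding empirical_def
proof (rule measurable_distr2)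
  have "(\<lambda>p. fst p (snd p)) \<in> PiM {..<N} (\<lambda>_. borel :: 'a measure) \<Otimes>\<^sub>M count_space {..<N} \<rightarrow>\<^sub>M borel"
    by (rule measurable_compose_countable'[where f = "\<lambda>i p. fst p i" and g = snd and I = "{..<N}"])
       (auto intro: measurable_compose[OF measurable_fst])
  then show "(\<lambda>(X, i). X i) \<in> PiM {..<N} (\<lambda>_. borel :: 'a measure) \<Otimes>\<^sub>M uniform_count_measure {..<N} \<rightarrow>\<^sub>M borel"
    by (subst measurable_cong_sets[OF sets_pair_measure_cong[OF refl sets_uniform_count_measure_count_space] refl])
       (simp add: case_prod_beta')
  have "prob_space (uniform_count_measure {..<N})"
    using assms by (intro prob_space_uniform_count_measure) (auto simp: lessThan_empty_iff)
  then show "(\<lambda>_. uniform_count_measure {..<N}) \<in> PiM {..<N} (\<lambda>_. borel) \<rightarrow>\<^sub>M subprob_algebra (uniform_count_measure {..<N})"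
    by (intro measurable_const) (auto simp: space_subprob_algebra prob_space_imp_subprob_space)
qed

lemma borel_measurable_offdiag_integral:
  fixes k :: "'a::euclidean_space \<Rightarrow> 'a \<Rightarrow> real"
  assumes "\<mu> \<in> L \<rightarrow>\<^sub>M subprob_algebra borel" "\<nu> \<in> L \<rightarrow>\<^sub>M subprob_algebra borel"
    and "(\<lambda>p. indicator {(x, y). x \<noteq> y} p *\<^sub>R k (fst p) (snd p)) \<in> borel_measurable (borel \<Otimes>\<^sub>M borel)"
  shows "(\<lambda>x. offdiag_integral (\<mu> x) (\<nu> x) k) \<in> borel_measurable L"
  unfolding offdiag_integral_def set_lebesgue_integral_def
  using measurable_compose[OF measurable_pair_measure[OF assms(1,2)] integral_measurable_subprob_algebra[OF assms(3)]] .

lemma borel_measurable_commutator: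
  fixes v :: "'a::euclidean_space \<Rightarrow> 'a"
  assumes "N \<ge> 1" "borel_prob \<mu>" "globally_lipschitz v"
  shows "(\<lambda>X. commutator s N v X \<mu>) \<in> borel_measurable (PiM {..<N} (\<lambda>_. borel))"
proof -
  have "continuous_on UNIV v"
    using assms(3) by (auto simp: globally_lipschitz_def intro: lipschitz_on_continuous_on)
  then have [measurable]: "v \<in> borel_measurable borel"
    by (rule borel_measurable_continuous_onI)
  have [measurable]: "{(x, y). x \<noteq> y} \<in> sets (borel \<Otimes>\<^sub>M (borel :: 'a measure))"
  proof -
    have "open {p :: 'a \<times> 'a. fst p \<noteq> snd p}"
      by (intro open_Collect_neq continuous_intros)
    moreover have "{(x, y). x \<noteq> y} = {p :: 'a \<times> 'a. fst p \<noteq> snd p}"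
      by auto
    ultimately show ?thesis
      unfolding borel_prod by simp
  qed
  \<comment> \<open>The indicator removes the diagonal, the only place where
    \<open>grad_riesz\<close> does not apply.\<close>
  have eq: "(\<lambda>p. indicator {(x, y). x \<noteq> y} p *\<^sub>R (grad (riesz s) (fst p - snd p) \<bullet> (v (fst p) - v (snd p)))) =
      (\<lambda>p. indicator {(x, y). x \<noteq> y} p * (- (norm (fst p - snd p) powr (- s - 2)) * ((fst p - snd p) \<bullet> (v (fst p) - v (snd p)))))"
    by (auto simp: fun_eq_iff indicator_def grad_riesz)
  have k: "(\<lambda>p. indicator {(x, y). x \<noteq> y} p *\<^sub>R (grad (riesz s) (fst p - snd p) \<bullet> (v (fst p) - v (snd p))))
      \<in> borel_measurable (borel \<Otimes>\<^sub>M borel)"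
    unfolding eq by measurable
  have \<mu>: "(\<lambda>_. \<mu>) \<in> PiM {..<N} (\<lambda>_. borel) \<rightarrow>\<^sub>M subprob_algebra borel"
    using borel_prob_in_subprob_algebra[OF assms(2)] by simp
  note emp = measurable_empirical[OF assms(1)]
  show ?thesis
    unfolding commutator_def offdiag_square_def
    using borel_measurable_offdiag_integral[OF emp emp k] borel_measurable_offdiag_integral[OF emp \<mu> k]
      borel_measurable_offdiag_integral[OF \<mu> emp k] borel_measurable_offdiag_integral[OF \<mu> \<mu> k]
    by (intro borel_measurable_add borel_measurable_diff)
qed

section \<open>Finite free energy and the modulated Gibbs law\<close>

lemma sets_tensor_power: "borel_prob \<mu> \<Longrightarrow> sets (tensor_power N \<mu>) = sets (PiM {..<N} (\<lambda>_. borel))"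
  unfolding tensor_power_def by (intro sets_PiM_cong) (auto simp: borel_prob_def)

lemma prob_space_tensor_power: "borel_prob \<mu> \<Longrightarrow> prob_space (tensor_power N \<mu>)"
  unfolding tensor_power_def by (intro prob_space_PiM) (auto simp: borel_prob_def)

text \<open>In \<open>ereal\<close> a sum with a summand \<open>\<infinity>\<close> equals
  \<open>\<infinity>\<close>, even if the other one is \<open>- \<infinity>\<close>. A finite total
  therefore forces a finite entropy, then a finite mean energy, and then finite positive and
  negative parts of it.\<close>

lemma mod_free_energy_finiteD:
  assumes "\<beta> > 0" "N \<ge> 1" and \<mu>: "borel_prob \<mu>" and f: "particle_law N f"
    and fin: "\<bar>mod_free_energy s \<beta> N f \<mu>\<bar> \<noteq> \<infinity>"
  shows "absolutely_continuous (tensor_power N \<mu>) f"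
    and "integrable f (entropy_density (exp 1) (tensor_power N \<mu>) f)"
    and "integrable f (\<lambda>X. mod_energy s N X \<mu>)"
    and "mod_free_energy s \<beta> N f \<mu> = ereal (1 / (\<beta> * real N) * KL_divergence (exp 1) (tensor_power N \<mu>) f
           + (\<integral>X. mod_energy s N X \<mu> \<partial>f))"
proof -
  let ?F = "\<lambda>X. mod_energy s N X \<mu>"
  have pos: "1 / (\<beta> * real N) > 0" using assms(1,2) by simp
  have F: "?F \<in> borel_measurable f"
    using borel_measurable_mod_energy[OF \<mu>] f measurable_cong_sets[of f] by (auto simp: particle_law_def)
  have ent: "rel_entropy f (tensor_power N \<mu>) \<noteq> \<infinity>"
  proof
    assume "rel_entropy f (tensor_power N \<mu>) = \<infinity>"
    moreover have "ereal (1 / (\<beta> * real N)) * \<infinity> = \<infinity>"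
      using assms(1,2) by simp
    ultimately show False
      using fin unfolding mod_free_energy_def by simp
  qed
  then show "absolutely_continuous (tensor_power N \<mu>) f"
    and "integrable f (entropy_density (exp 1) (tensor_power N \<mu>) f)"
    by (auto simp: rel_entropy_def split: if_splits)
  have ent_eq: "rel_entropy f (tensor_power N \<mu>) = ereal (KL_divergence (exp 1) (tensor_power N \<mu>) f)"
    using ent by (auto simp: rel_entropy_def split: if_splits)
  have "\<bar>ext_expectation f ?F\<bar> \<noteq> \<infinity>"
    using fin unfolding mod_free_energy_def ent_eq by (cases "ext_expectation f ?F") auto
  then have nn: "(\<integral>\<^sup>+X. ennreal (?F X) \<partial>f) \<noteq> \<infinity>" "(\<integral>\<^sup>+X. ennreal (- ?F X) \<partial>f) \<noteq> \<infinity>"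
    unfolding ext_expectation_def
    by (cases "\<integral>\<^sup>+X. ennreal (?F X) \<partial>f"; cases "\<integral>\<^sup>+X. ennreal (- ?F X) \<partial>f"; force)+
  show int: "integrable f ?F"
    unfolding real_integrable_def using F nn by auto
  have "ext_expectation f ?F = ereal (\<integral>X. ?F X \<partial>f)"
    unfolding ext_expectation_def real_lebesgue_integral_def[OF int] using nn
    by (cases "\<integral>\<^sup>+X. ennreal (?F X) \<partial>f"; cases "\<integral>\<^sup>+X. ennreal (- ?F X) \<partial>f") auto
  then show "mod_free_energy s \<beta> N f \<mu> = ereal (1 / (\<beta> * real N) * KL_divergence (exp 1) (tensor_power N \<mu>) f
           + (\<integral>X. ?F X \<partial>f))"
    unfolding mod_free_energy_def ent_eq by simp
qed

lemma partition_fun_pos: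
  assumes "borel_prob \<mu>"
  shows "partition_fun s \<beta> N \<mu> > 0"
proof -
  interpret prob_space "tensor_power N \<mu>" by (rule prob_space_tensor_power[OF assms])
  have [measurable]: "(\<lambda>X. mod_energy s N X \<mu>) \<in> borel_measurable (tensor_power N \<mu>)"
    using borel_measurable_mod_energy[OF assms] measurable_cong_sets[OF sets_tensor_power[OF assms] refl] by blast
  have "partition_fun s \<beta> N \<mu> \<noteq> 0"
  proof
    assume "partition_fun s \<beta> N \<mu> = 0"
    then have "AE X in tensor_power N \<mu>. ennreal (exp (- \<beta> * real N * mod_energy s N X \<mu>)) = 0"
      unfolding partition_fun_def by (subst (asm) nn_integral_0_iff_AE) auto
    then have "AE X in tensor_power N \<mu>. False"
      by eventually_elim simp
    then show False by simp
  qed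
  then show ?thesis by (simp add: zero_less_iff_neq_zero)
qed

text \<open>Moments under the modulated Gibbs law become moments under the tensor power at the price
  of the partition function. That factor cancels because it is positive and finite; the product form
  leaves no quotient in \<open>ennreal\<close>.\<close>

lemma nn_integral_mod_gibbs:
  assumes \<mu>: "borel_prob \<mu>" and K: "partition_fun s \<beta> N \<mu> < \<infinity>"
    and h: "h \<in> borel_measurable (PiM {..<N} (\<lambda>_. borel))"
  shows "partition_fun s \<beta> N \<mu> * (\<integral>\<^sup>+X. h X \<partial>mod_gibbs s \<beta> N \<mu>) =
    (\<integral>\<^sup>+X. ennreal (exp (- \<beta> * real N * mod_energy s N X \<mu>)) * h X \<partial>tensor_power N \<mu>)"
proof -
  let ?K = "partition_fun s \<beta> N \<mu>"
  have [measurable]: "(\<lambda>X. mod_energy s N X \<mu>) \<in> borel_measurable (tensor_power N \<mu>)"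
    "h \<in> borel_measurable (tensor_power N \<mu>)"
    using borel_measurable_mod_energy[OF \<mu>] h measurable_cong_sets[OF sets_tensor_power[OF \<mu>] refl] by blast+
  have cancel: "?K * (y / ?K * z) = y * z" for y z
    using partition_fun_pos[OF \<mu>, of s \<beta> N] K
    by (metis ennreal_divide_times ennreal_times_divide infinity_ennreal_def mult.assoc mult.commute
        mult_divide_eq_ennreal order_less_irrefl)
  have "?K * (\<integral>\<^sup>+X. h X \<partial>mod_gibbs s \<beta> N \<mu>) =
      (\<integral>\<^sup>+X. ?K * (ennreal (exp (- \<beta> * real N * mod_energy s N X \<mu>)) / ?K * h X) \<partial>tensor_power N \<mu>)"
    unfolding mod_gibbs_def by (subst nn_integral_density) (auto intro: nn_integral_cmult[symmetric])
  also have "\<dots> = (\<integral>\<^sup>+X. ennreal (exp (- \<beta> * real N * mod_energy s N X \<mu>)) * h X \<partial>tensor_power N \<mu>)"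
    unfolding cancel ..
  finally show ?thesis .
qed

lemma prob_space_mod_gibbs:
  assumes \<mu>: "borel_prob \<mu>" and K: "partition_fun s \<beta> N \<mu> < \<infinity>"
  shows "prob_space (mod_gibbs s \<beta> N \<mu>)"
proof (rule prob_spaceI)
  let ?K = "partition_fun s \<beta> N \<mu>" and ?Q = "mod_gibbs s \<beta> N \<mu>"
  have "?K * emeasure ?Q (space ?Q) = ?K * 1"
    using nn_integral_mod_gibbs[OF \<mu> K, of "\<lambda>_. 1"] by (simp add: partition_fun_def)
  then show "emeasure ?Q (space ?Q) = 1"
    using partition_fun_pos[OF \<mu>, of s \<beta> N] K
    by (subst (asm) ennreal_mult_cancel_left) auto
qed

text \<open>The two signs together exclude \<open>C < 1\<close>, because \<open>exp x + exp (- x) \<ge> 2\<close>.\<close>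

lemma exp_moment_const_ge_1:
  assumes "prob_space Q" and g [measurable]: "g \<in> borel_measurable Q"
    and "(\<integral>\<^sup>+x. ennreal (exp (g x)) \<partial>Q) \<le> ennreal C" "(\<integral>\<^sup>+x. ennreal (exp (- g x)) \<partial>Q) \<le> ennreal C"
  shows "C \<ge> 1"
proof -
  interpret prob_space Q by fact
  have two: "2 \<le> exp x + exp (- x)" for x :: real
    using exp_ge_add_one_self[of x] exp_ge_add_one_self[of "- x"] by linarith
  have "ennreal 2 = (\<integral>\<^sup>+x. ennreal 2 \<partial>Q)"
    by (simp add: emeasure_space_1)
  also have "\<dots> \<le> (\<integral>\<^sup>+x. ennreal (exp (g x)) + ennreal (exp (- g x)) \<partial>Q)"
    using two by (intro nn_integral_mono) (simp add: ennreal_plus[symmetric] del: ennreal_plus ennreal_numeral)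
  also have "\<dots> = (\<integral>\<^sup>+x. ennreal (exp (g x)) \<partial>Q) + (\<integral>\<^sup>+x. ennreal (exp (- g x)) \<partial>Q)"
    by (rule nn_integral_add) measurable
  also have "\<dots> \<le> ennreal C + ennreal C"
    using assms(3,4) by (rule add_mono)
  \<comment> \<open>\<open>ennreal\<close> sends negative reals to 0, hence \<open>max C 0\<close>;
    comparison with 2 then excludes \<open>C < 1\<close>.\<close>
  also have "\<dots> = ennreal (2 * max C 0)"
    by (cases "C \<ge> 0") (auto simp: ennreal_plus[symmetric] ennreal_neg simp del: ennreal_plus)
  finally show ?thesis
    by (subst (asm) ennreal_le_iff) auto
qed

text \<open>A commutator that is not integrable has expectation \<open>0\<close> by convention; the bound then follows from the
  entropy inequality with test function \<open>- \<beta> N F\<close>, which is why \<open>\<sigma> = 0\<close> is allowed below.\<close>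

lemma commutator_expectation_le:
  fixes v :: "'a::euclidean_space \<Rightarrow> 'a"
  assumes \<beta>: "\<beta> > 0" and N: "N \<ge> 1"
    and em: "exp_moment_bound s \<beta> eps Cem" and ub: "partition_bound s \<beta> Cub"
    and adm: "admissible s \<mu>" and v: "globally_lipschitz v" and f: "particle_law N f"
    and fin: "\<bar>mod_free_energy s \<beta> N f \<mu>\<bar> \<noteq> \<infinity>"
  shows "1 / real N * \<bar>\<integral>X. real N * commutator s N v X \<mu> \<partial>f\<bar>
    \<le> rate_const \<beta> eps \<mu> v * real_of_ereal (mod_free_energy s \<beta> N f \<mu>) + error_const eps Cem Cub \<mu> v / real N"
proof -
  let ?M = "tensor_power N \<mu>" and ?K = "partition_fun s \<beta> N \<mu>"
  let ?F = "\<lambda>X. mod_energy s N X \<mu>"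
  define A where "A X = real N * commutator s N v X \<mu>" for X
  define \<epsilon> where "\<epsilon> = eps \<mu> v"
  define B where "B = max (exp 1) (Cub \<mu>)"
  define E where "E = real_of_ereal (mod_free_energy s \<beta> N f \<mu>)"
  have \<mu>: "borel_prob \<mu>" using adm by (simp add: admissible_def)
  note facts = mod_free_energy_finiteD[OF \<beta> N \<mu> f fin]
  have E: "E = 1 / (\<beta> * real N) * KL_divergence (exp 1) ?M f + (\<integral>X. ?F X \<partial>f)"
    unfolding E_def facts(4) by simp
  have \<epsilon>: "\<epsilon> > 0"
    and moment: "\<And>\<sigma>. \<sigma> \<in> {1, -1} \<Longrightarrow> (\<integral>\<^sup>+X. ennreal (exp (\<sigma> * \<epsilon> * A X)) \<partial>mod_gibbs s \<beta> N \<mu>) \<le> ennreal (Cem \<mu> v)"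
    using em adm v N unfolding exp_moment_bound_def \<epsilon>_def A_def by (auto simp: mult.assoc)
  have "?K \<le> ennreal (Cub \<mu>)"
    using ub adm N by (auto simp: partition_bound_def)
  also have "\<dots> \<le> ennreal B"
    by (intro ennreal_leI) (simp add: B_def)
  finally have K: "?K \<le> ennreal B" .
  then have K_fin: "?K < \<infinity>"
    by (simp add: le_less_trans)
  have B: "B > 0"
    unfolding B_def by (intro less_le_trans[OF exp_gt_zero max.cobounded1])
  have A_meas: "A \<in> borel_measurable (PiM {..<N} (\<lambda>_. borel))"
    unfolding A_def using borel_measurable_commutator[OF N \<mu> v] by measurable
  have Q_sets: "sets (mod_gibbs s \<beta> N \<mu>) = sets (PiM {..<N} (\<lambda>_. borel))"
    using sets_tensor_power[OF \<mu>] by (simp add: mod_gibbs_def)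
  \<comment> \<open>This splits \<open>ln (B * Cem \<mu> v)\<close>, and it lets the case
    \<open>\<sigma> = 0\<close>, whose moment is 1, share the bound.\<close>
  have C: "Cem \<mu> v \<ge> 1"
  proof (rule exp_moment_const_ge_1[OF prob_space_mod_gibbs[OF \<mu> K_fin]])
    show "(\<lambda>X. \<epsilon> * A X) \<in> borel_measurable (mod_gibbs s \<beta> N \<mu>)"
      using A_meas by (subst measurable_cong_sets[OF Q_sets refl]) measurable
  qed (use moment[of 1] moment[of "-1"] in simp_all)
  have variational: "(\<integral>X. \<sigma> * \<epsilon> * A X - \<beta> * real N * ?F X \<partial>f) \<le> KL_divergence (exp 1) ?M f + ln (B * Cem \<mu> v)"
    if \<sigma>: "\<sigma> \<in> {1, -1, 0}" and int: "integrable f (\<lambda>X. \<sigma> * \<epsilon> * A X)" for \<sigma>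
  proof (rule integral_le_KL_divergence_plus_ln[OF prob_space_tensor_power[OF \<mu>] _ _ facts(1,2)])
    show "prob_space f" "sets f = sets ?M"
      using f sets_tensor_power[OF \<mu>] by (auto simp: particle_law_def)
    show "integrable f (\<lambda>X. \<sigma> * \<epsilon> * A X - \<beta> * real N * ?F X)"
      using facts(3) by (intro Bochner_Integration.integrable_diff[OF int] integrable_mult_right)
    have "(\<integral>\<^sup>+X. ennreal (exp (\<sigma> * \<epsilon> * A X - \<beta> * real N * ?F X)) \<partial>?M)
        = (\<integral>\<^sup>+X. ennreal (exp (- \<beta> * real N * ?F X)) * ennreal (exp (\<sigma> * \<epsilon> * A X)) \<partial>?M)"
      by (intro nn_integral_cong) (simp add: ennreal_mult[symmetric] exp_add[symmetric])
    also have "\<dots> = ?K * (\<integral>\<^sup>+X. ennreal (exp (\<sigma> * \<epsilon> * A X)) \<partial>mod_gibbs s \<beta> N \<mu>)"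
      using A_meas by (intro nn_integral_mod_gibbs[OF \<mu> K_fin, symmetric]) measurable
    also have "\<dots> \<le> ennreal B * ennreal (Cem \<mu> v)"
    proof (rule mult_mono[OF K])
      interpret Q: prob_space "mod_gibbs s \<beta> N \<mu>" by (rule prob_space_mod_gibbs[OF \<mu> K_fin])
      show "(\<integral>\<^sup>+X. ennreal (exp (\<sigma> * \<epsilon> * A X)) \<partial>mod_gibbs s \<beta> N \<mu>) \<le> ennreal (Cem \<mu> v)"
      proof (cases "\<sigma> = 0")
        case True
        then show ?thesis using C by (simp add: Q.emeasure_space_1)
      next
        case False
        then show ?thesis using moment \<sigma> by blast
      qed
    qed auto
    also have "\<dots> = ennreal (B * Cem \<mu> v)"
      using B C by (simp add: ennreal_mult)
    finally show "(\<integral>\<^sup>+X. ennreal (exp (\<sigma> * \<epsilon> * A X - \<beta> * real N * ?F X)) \<partial>?M) \<le> ennreal (B * Cem \<mu> v)" .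
    show "B * Cem \<mu> v > 0" using B C by simp
  qed
  have bound: "\<sigma> * \<epsilon> * (\<integral>X. A X \<partial>f) \<le> \<beta> * real N * E + (ln B + ln (Cem \<mu> v))"
    if \<sigma>: "\<sigma> \<in> {1, -1, 0}" and int: "integrable f (\<lambda>X. \<sigma> * \<epsilon> * A X)" for \<sigma>
  proof -
    have "(\<integral>X. \<sigma> * \<epsilon> * A X - \<beta> * real N * ?F X \<partial>f) = \<sigma> * \<epsilon> * (\<integral>X. A X \<partial>f) - \<beta> * real N * (\<integral>X. ?F X \<partial>f)"
      using facts(3)
      by (subst Bochner_Integration.integral_diff[OF int])
         (simp, simp only: integral_mult_right_zero)
    \<comment> \<open>Entropy and subtracted energy reassemble into the free energy, which dictates
      the factor \<open>\<beta> * real N\<close> in the test function.\<close>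
    moreover have "\<beta> * real N * E = KL_divergence (exp 1) ?M f + \<beta> * real N * (\<integral>X. ?F X \<partial>f)"
      unfolding E using \<beta> N by (simp add: field_simps)
    moreover have "ln (B * Cem \<mu> v) = ln B + ln (Cem \<mu> v)"
      using B C by (simp add: ln_mult)
    ultimately show ?thesis
      using variational[OF that] by linarith
  qed
  have "\<epsilon> * \<bar>\<integral>X. A X \<partial>f\<bar> \<le> \<beta> * real N * E + (ln B + ln (Cem \<mu> v))"
  proof (cases "integrable f A")
    case True
    then show ?thesis
      using bound[of 1] bound[of "-1"] \<epsilon> by (simp add: abs_if)
  next
    case False
    then show ?thesis
      using bound[of 0] by (simp add: not_integrable_integral_eq)
  qed
  then have "\<bar>\<integral>X. A X \<partial>f\<bar> \<le> (\<beta> * real N * E + (ln B + ln (Cem \<mu> v))) / \<epsilon>"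
    using \<epsilon> by (simp add: pos_le_divide_eq mult.commute)
  then have "1 / real N * \<bar>\<integral>X. A X \<partial>f\<bar> \<le> 1 / real N * ((\<beta> * real N * E + (ln B + ln (Cem \<mu> v))) / \<epsilon>)"
    by (intro mult_left_mono) auto
  also have "\<dots> = \<beta> / \<epsilon> * E + 1 / \<epsilon> * (ln B + ln (Cem \<mu> v)) / real N"
    using N \<epsilon> by (simp add: field_simps)
  finally show ?thesis
    by (simp add: rate_const_def error_const_def A_def \<epsilon>_def B_def E_def)
qed

section \<open>Differential inequality for the modulated free energy\<close>

theorem theorem2p9:
  fixes T :: ereal and s \<beta> :: real and N :: nat
    and \<mu> :: "real \<Rightarrow> 'a::euclidean_space measure"
    and u :: "real \<Rightarrow> 'a \<Rightarrow> 'a"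
    and f :: "real \<Rightarrow> (nat \<Rightarrow> 'a) measure"
    and eps Cem :: "'a measure \<Rightarrow> ('a \<Rightarrow> 'a) \<Rightarrow> real" and Cub :: "'a measure \<Rightarrow> real"
  assumes T: "0 < T" and \<beta>: "\<beta> > 0" and s: "0 \<le> s" "s < real DIM('a) / 2" and N: "N \<ge> 1"
    and em: "exp_moment_bound s \<beta> eps Cem"
    and ub: "partition_bound s \<beta> Cub"
    and prob: "\<And>t. 0 \<le> t \<Longrightarrow> ereal t < T \<Longrightarrow> borel_prob (\<mu> t)"
    and mv: "mckean_vlasov_solution s \<beta> T \<mu>"
    and ce: "continuity_equation T \<mu> u"
    and law: "\<And>t. 0 \<le> t \<Longrightarrow> ereal t < T \<Longrightarrow> particle_law N (f t)"
    and fin: "\<And>t. 0 \<le> t \<Longrightarrow> ereal t < T \<Longrightarrow> \<bar>mod_free_energy s \<beta> N (f t) (\<mu> t)\<bar> \<noteq> \<infinity>"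
    and ac: "\<And>t. 0 \<le> t \<Longrightarrow> ereal t < T \<Longrightarrow>
      abs_continuous_on {0..t} (\<lambda>r. real_of_ereal (mod_free_energy s \<beta> N (f r) (\<mu> r)))"
    and dissipation: "AE t in lborel. 0 < t \<and> ereal t < T \<longrightarrow>
      (\<exists>D. ((\<lambda>r. real_of_ereal (mod_free_energy s \<beta> N (f r) (\<mu> r))) has_real_derivative D) (at t) \<and>
           D \<le> 1 / real N * \<bar>\<integral>X. real N * commutator s N (u t) X (\<mu> t) \<partial>f t\<bar>)"
    and regularity: "AE t in lborel. 0 < t \<and> ereal t < T \<longrightarrow>
      admissible s (\<mu> t) \<and> globally_lipschitz (u t)"
    and finite_A: "\<And>t. 0 \<le> t \<Longrightarrow> ereal t < T \<Longrightarrow>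
      set_integrable lebesgue {0..t} (\<lambda>\<tau>. rate_const \<beta> eps (\<mu> \<tau>) (u \<tau>))"
    and finite_B: "\<And>t. 0 \<le> t \<Longrightarrow> ereal t < T \<Longrightarrow>
      set_integrable lebesgue {0..t}
        (\<lambda>\<tau>. growth_factor (\<lambda>r. rate_const \<beta> eps (\<mu> r) (u r)) \<tau> t
              * error_const eps Cem Cub (\<mu> \<tau>) (u \<tau>))"
  shows "\<And>t. 0 \<le> t \<Longrightarrow> ereal t < T \<Longrightarrow>
    mod_free_energy s \<beta> N (f t) (\<mu> t)
      \<le> ereal (growth_factor (\<lambda>r. rate_const \<beta> eps (\<mu> r) (u r)) 0 t)
          * mod_free_energy s \<beta> N (f 0) (\<mu> 0)
        + ereal (accumulated_error (\<lambda>r. rate_const \<beta> eps (\<mu> r) (u r))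
                   (\<lambda>r. error_const eps Cem Cub (\<mu> r) (u r)) t / real N)"
proof -
  fix t assume t: "0 \<le> t" "ereal t < T"
  define E where "E r = real_of_ereal (mod_free_energy s \<beta> N (f r) (\<mu> r))" for r
  define c where "c r = rate_const \<beta> eps (\<mu> r) (u r)" for r
  define b where "b r = error_const eps Cem Cub (\<mu> r) (u r)" for r
  have up_to_t: "ereal r < T" if "r \<le> t" for r
    using t that by (metis ereal_less_eq(3) le_less_trans)
  have c_int: "c absolutely_integrable_on {0..t}"
    using finite_A[OF t] by (simp add: c_def[abs_def])
  \<comment> \<open>\<open>growth_factor\<close> contains a Lebesgue integral, the Gronwall lemmas
    gauge integrals; the two agree for absolutely integrable functions.\<close>
  have growth: "growth_factor c r t = exp (integral {r..t} c)" if "r \<in> {0..t}" for r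
  proof -
    have "c absolutely_integrable_on {r..t}"
      using that by (intro set_integrable_subset[OF c_int]) auto
    then show ?thesis
      by (simp add: growth_factor_def set_lebesgue_integral_eq_integral(2))
  qed
  have wb_int: "(\<lambda>r. growth_factor c r t * b r) absolutely_integrable_on {0..t}"
    using finite_B[OF t] by (simp add: c_def[abs_def] b_def)
  \<comment> \<open>Integrability is given for \<open>b\<close> times the growth factor. The inverse
    factor is continuous on the compact interval, so multiplying by it recovers integrability of
    \<open>b\<close>.\<close>
  have "continuous_on {0..t} (\<lambda>r. exp (- integral {r..t} c))"
    using c_int by (intro continuous_intros indefinite_integral_continuous_1' set_lebesgue_integral_eq_integral(1))
  then have "(\<lambda>r. exp (- integral {r..t} c) * (growth_factor c r t * b r)) absolutely_integrable_on {0..t}"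
    using wb_int by (rule absolutely_integrable_mult_continuous)
  also have "?this \<longleftrightarrow> b absolutely_integrable_on {0..t}"
    by (intro set_integrable_cong) (auto simp: growth exp_minus)
  finally have b_int: "(\<lambda>r. b r / real N) absolutely_integrable_on {0..t}"
    by (rule set_integrable_divide)
  have deriv: "AE r in lborel. 0 < r \<and> r < t \<longrightarrow>
      (\<exists>D. (E has_real_derivative D) (at r) \<and> D \<le> c r * E r + b r / real N)"
    using dissipation regularity
  proof eventually_elim
    case (elim r)
    show ?case
    proof (intro impI)
      assume r: "0 < r \<and> r < t"
      then have rT: "0 \<le> r" "ereal r < T" using up_to_t by auto
      obtain D where D: "(E has_real_derivative D) (at r)"
        "D \<le> 1 / real N * \<bar>\<integral>X. real N * commutator s N (u r) X (\<mu> r) \<partial>f r\<bar>"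
        using elim(1) r rT unfolding E_def by auto
      have "1 / real N * \<bar>\<integral>X. real N * commutator s N (u r) X (\<mu> r) \<partial>f r\<bar> \<le> c r * E r + b r / real N"
        unfolding c_def E_def b_def
        using elim(2) r rT by (intro commutator_expectation_le[OF \<beta> N em ub _ _ law fin]) auto
      then show "\<exists>D. (E has_real_derivative D) (at r) \<and> D \<le> c r * E r + b r / real N"
        using D by force
    qed
  qed
  have "abs_continuous_on {0..t} E"
    using ac[OF t] by (simp add: E_def[abs_def])
  then have "E t \<le> exp (integral {0..t} c) * E 0 + integral {0..t} (\<lambda>r. exp (integral {r..t} c) * (b r / real N))"
    using t(1) c_int b_int deriv by (intro gronwall_abs_continuous) auto
  also have "exp (integral {0..t} c) = growth_factor c 0 t"
    using t(1) by (simp add: growth)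
  also have "integral {0..t} (\<lambda>r. exp (integral {r..t} c) * (b r / real N))
      = integral {0..t} (\<lambda>r. growth_factor c r t * b r / real N)"
    by (intro Henstock_Kurzweil_Integration.integral_cong) (simp add: growth)
  also have "\<dots> = accumulated_error c b t / real N"
    unfolding accumulated_error_def set_lebesgue_integral_eq_integral(2)[OF wb_int]
    by simp
  finally have "E t \<le> growth_factor c 0 t * E 0 + accumulated_error c b t / real N" .
  moreover have "mod_free_energy s \<beta> N (f r) (\<mu> r) = ereal (E r)" if "0 \<le> r" "r \<le> t" for r
    using fin[OF that(1) up_to_t[OF that(2)]] by (simp add: E_def ereal_real)
  ultimately show "mod_free_energy s \<beta> N (f t) (\<mu> t)
      \<le> ereal (growth_factor (\<lambda>r. rate_const \<beta> eps (\<mu> r) (u r)) 0 t) * mod_free_energy s \<beta> N (f 0) (\<mu> 0)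
        + ereal (accumulated_error (\<lambda>r. rate_const \<beta> eps (\<mu> r) (u r))
                   (\<lambda>r. error_const eps Cem Cub (\<mu> r) (u r)) t / real N)"
    using t(1) by (simp add: c_def[abs_def] b_def[abs_def])
qed

end
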